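(* Let $\Lambda$ be a finite dimensional algebra over an algebraically closed field $k$ with $\mathrm{s.gl.dim}(\Lambda)\geq 1$ (possibly infinite). Then $\mathrm{s.gl.dim}(\Lambda)=m_0-2$, where $$m_0:=\min\{n\geq 2\mid \text{for every indecomposable } X\in C_n(\mathrm{proj}\Lambda),\ X^1=0\text{ or }X^n=0\},$$ with the convention that $\min\emptyset=\infty$.
   Context: $\mathrm{proj}\Lambda$ is the category of finitely generated projective right $\Lambda$-modules. For $n\geq 1$, $C_n(\mathrm{proj}\Lambda)$ is the full subcategory of the category of complexes $X=(X^i,d_X^i)_{i\in\mathbb{Z}}$ over $\mathrm{proj}\Lambda$ (with $d_X^i\colon X^i\to X^{i+1}$) with $X^i=0$ for $i\notin\{1,\dots,n\}$; indecomposability is meant in the category of complexes. Strong global dimension: each nonzero $X\in K^b(\mathrm{proj}\Lambda)$ has a representative $\bar X$ in $C^b(\mathrm{proj}\Lambda)$, unique up to isomorphism of complexes, without nonzero contractible direct summands (i.e. without indecomposable projective direct summands in $C^b(\mathrm{proj}\Lambda)$); if $\bar X^r\neq 0\neq\bar X^s$ and $\bar X^i=0$ for $i<r$ and $i>s$, then $\ell(X)=s-r$. $\mathrm{s.gl.dim}(\Lambda)=\sup\{\ell(X)\mid X\in K^b(\mathrm{proj}\Lambda)\text{ indecomposable}\}\in\mathbb{N}\cup\{\infty\}$. *)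

theory Defs
  imports
    "HOL-Algebra.Ring"
    "HOL-Computational_Algebra.Polynomial"
    "HOL-Library.Extended_Nat"
begin

section \<open>Finite dimensional algebras\<close>

text \<open>The algebra \<open>\<Lambda>\<close> is a type \<open>'a\<close> of class \<open>ring_1\<close> (associative, unital, not necessarily
  commutative, \<open>1 \<noteq> 0\<close>), with an action \<open>scale\<close> of the base field. The assumption
  \<open>1 \<noteq> 0\<close> only excludes the zero algebra, over which every complex of modules is zero.\<close>

locale finite_dim_algebra =
  fixes scale :: "'k::field \<Rightarrow> 'a::ring_1 \<Rightarrow> 'a"
  assumes finite_dim: "\<exists>B. finite_dimensional_vector_space scale B"
    and scale_mult_left: "scale c x * y = scale c (x * y)"
    and scale_mult_right: "x * scale c y = scale c (x * y)"


section \<open>Finitely generated projective right modules\<close>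

text \<open>As for the modules of HOL-Algebra, extending the ring record makes \<open>abelian_group\<close> available;
  the fields \<open>mult\<close> and \<open>one\<close> are not used.\<close>

record ('a, 'm) rmodule = "'m ring" +
  act :: "'m \<Rightarrow> 'a \<Rightarrow> 'm" (infixl \<open>\<triangleleft>\<index>\<close> 75)

locale right_module = abelian_group M
  for M :: "('a::ring_1, 'm) rmodule" (structure) +
  assumes act_closed: "x \<in> carrier M \<Longrightarrow> x \<triangleleft> r \<in> carrier M"
    and act_add_left: "x \<in> carrier M \<Longrightarrow> y \<in> carrier M \<Longrightarrow> (x \<oplus> y) \<triangleleft> r = x \<triangleleft> r \<oplus> y \<triangleleft> r"
    and act_add_right: "x \<in> carrier M \<Longrightarrow> x \<triangleleft> (r + s) = x \<triangleleft> r \<oplus> x \<triangleleft> s"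
    and act_mult: "x \<in> carrier M \<Longrightarrow> x \<triangleleft> (r * s) = (x \<triangleleft> r) \<triangleleft> s"
    and act_one: "x \<in> carrier M \<Longrightarrow> x \<triangleleft> 1 = x"

definition rmod_hom :: "('a::ring_1, 'm) rmodule \<Rightarrow> ('a, 'n) rmodule \<Rightarrow> ('m \<Rightarrow> 'n) set" where
  "rmod_hom M N = {f. f \<in> carrier M \<rightarrow> carrier N \<and>
     (\<forall>x\<in>carrier M. \<forall>y\<in>carrier M. f (x \<oplus>\<^bsub>M\<^esub> y) = f x \<oplus>\<^bsub>N\<^esub> f y) \<and>
     (\<forall>x\<in>carrier M. \<forall>r. f (x \<triangleleft>\<^bsub>M\<^esub> r) = f x \<triangleleft>\<^bsub>N\<^esub> r)}"

definition zero_module :: "('a::ring_1, 'm) rmodule \<Rightarrow> bool" where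
  "zero_module M \<longleftrightarrow> carrier M = {\<zero>\<^bsub>M\<^esub>}"

definition finitely_generated :: "('a::ring_1, 'm) rmodule \<Rightarrow> bool" where
  "finitely_generated M \<longleftrightarrow> (\<exists>S. finite S \<and> S \<subseteq> carrier M \<and>
     (\<forall>x\<in>carrier M. \<exists>c. x = (\<Oplus>\<^bsub>M\<^esub>s\<in>S. s \<triangleleft>\<^bsub>M\<^esub> c s)))"

text \<open>Modules are taken with carriers inside the type \<open>nat \<Rightarrow> 'a\<close>. Every \<open>\<Lambda>\<^sup>m\<close>, hence every quotient
  of some \<open>\<Lambda>\<^sup>m\<close>, can be realised on a subset of this type, so every finitely generated right
  module occurs up to isomorphism. For the same reason it is enough, for a finitely generated
  module, to test the lifting property on modules in this type: a surjection \<open>\<Lambda>\<^sup>m \<rightarrow> P\<close> is among the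
  test maps.\<close>

type_synonym 'a rmod = "('a, nat \<Rightarrow> 'a) rmodule"

definition projective :: "'a::ring_1 rmod \<Rightarrow> bool" where
  "projective P \<longleftrightarrow> (\<forall>(M :: 'a rmod) (N :: 'a rmod) p f.
     right_module M \<and> right_module N \<and>
     p \<in> rmod_hom M N \<and> p ` carrier M = carrier N \<and> f \<in> rmod_hom P N \<longrightarrow>
     (\<exists>g\<in>rmod_hom P M. \<forall>x\<in>carrier P. p (g x) = f x))"

definition proj_module :: "'a::ring_1 rmod \<Rightarrow> bool" where
  "proj_module P \<longleftrightarrow> right_module P \<and> finitely_generated P \<and> projective P"


section \<open>Complexes over \<open>proj \<Lambda>\<close>\<close>

record 'a cplx =
  cobj :: "int \<Rightarrow> 'a rmod"
  cdiff :: "int \<Rightarrow> (nat \<Rightarrow> 'a) \<Rightarrow> (nat \<Rightarrow> 'a)"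

definition proj_complex :: "'a::ring_1 cplx \<Rightarrow> bool" where
  "proj_complex X \<longleftrightarrow>
     (\<forall>i. proj_module (cobj X i)) \<and>
     (\<forall>i. cdiff X i \<in> rmod_hom (cobj X i) (cobj X (i + 1))) \<and>
     (\<forall>i. \<forall>x\<in>carrier (cobj X i). cdiff X (i + 1) (cdiff X i x) = \<zero>\<^bsub>cobj X (i + 2)\<^esub>)"

definition Cb :: "'a::ring_1 cplx \<Rightarrow> bool" where
  "Cb X \<longleftrightarrow> proj_complex X \<and> (\<exists>a b. \<forall>i. i < a \<or> b < i \<longrightarrow> zero_module (cobj X i))"

definition Cn :: "nat \<Rightarrow> 'a::ring_1 cplx \<Rightarrow> bool" where
  "Cn n X \<longleftrightarrow> proj_complex X \<and> (\<forall>i. i \<notin> {1..int n} \<longrightarrow> zero_module (cobj X i))"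

type_synonym 'a cmap = "int \<Rightarrow> (nat \<Rightarrow> 'a) \<Rightarrow> (nat \<Rightarrow> 'a)"

definition chain_map :: "'a::ring_1 cplx \<Rightarrow> 'a cplx \<Rightarrow> 'a cmap \<Rightarrow> bool" where
  "chain_map X Y f \<longleftrightarrow>
     (\<forall>i. f i \<in> rmod_hom (cobj X i) (cobj Y i)) \<and>
     (\<forall>i. \<forall>x\<in>carrier (cobj X i). cdiff Y i (f i x) = f (i + 1) (cdiff X i x))"

definition id_map :: "'a cmap" where
  "id_map = (\<lambda>i x. x)"

definition zero_map :: "'a::ring_1 cplx \<Rightarrow> 'a cmap" where
  "zero_map Y = (\<lambda>i x. \<zero>\<^bsub>cobj Y i\<^esub>)"

definition comp_map :: "'a cmap \<Rightarrow> 'a cmap \<Rightarrow> 'a cmap" where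
  "comp_map g f = (\<lambda>i x. g i (f i x))"

definition add_map :: "'a::ring_1 cplx \<Rightarrow> 'a cmap \<Rightarrow> 'a cmap \<Rightarrow> 'a cmap" where
  "add_map Y f g = (\<lambda>i x. f i x \<oplus>\<^bsub>cobj Y i\<^esub> g i x)"


section \<open>The category of complexes and the homotopy category\<close>

text \<open>Both categories have chain maps as representatives of morphisms \<open>X \<rightarrow> Y\<close>; they differ in when
  two chain maps are the same morphism. In the category of complexes this is agreement on the
  carriers (HOL functions being total), in the homotopy category it is homotopy. The
  categorical notions below take this relation as the parameter \<open>E\<close>, and the class of objects as
  the parameter \<open>ob\<close>.\<close>

type_synonym 'a map_rel = "'a cplx \<Rightarrow> 'a cplx \<Rightarrow> 'a cmap \<Rightarrow> 'a cmap \<Rightarrow> bool"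

definition map_eq :: "'a::ring_1 map_rel" where
  "map_eq X Y f g \<longleftrightarrow> (\<forall>i. \<forall>x\<in>carrier (cobj X i). f i x = g i x)"

definition homotopic :: "'a::ring_1 map_rel" where
  "homotopic X Y f g \<longleftrightarrow> (\<exists>h. (\<forall>i. h i \<in> rmod_hom (cobj X i) (cobj Y (i - 1))) \<and>
     (\<forall>i. \<forall>x\<in>carrier (cobj X i).
        f i x = g i x \<oplus>\<^bsub>cobj Y i\<^esub> (cdiff Y (i - 1) (h i x) \<oplus>\<^bsub>cobj Y i\<^esub> h (i + 1) (cdiff X i x))))"

definition zero_obj :: "'a::ring_1 map_rel \<Rightarrow> 'a cplx \<Rightarrow> bool" where
  "zero_obj E X \<longleftrightarrow> E X X id_map (zero_map X)"

definition iso_obj :: "'a::ring_1 map_rel \<Rightarrow> 'a cplx \<Rightarrow> 'a cplx \<Rightarrow> bool" where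
  "iso_obj E X Y \<longleftrightarrow> (\<exists>f g. chain_map X Y f \<and> chain_map Y X g \<and>
     E X X (comp_map g f) id_map \<and> E Y Y (comp_map f g) id_map)"

definition direct_sum :: "'a::ring_1 map_rel \<Rightarrow> 'a cplx \<Rightarrow> 'a cplx \<Rightarrow> 'a cplx \<Rightarrow> bool" where
  "direct_sum E X Y Z \<longleftrightarrow> (\<exists>i\<^sub>Y i\<^sub>Z p\<^sub>Y p\<^sub>Z.
     chain_map Y X i\<^sub>Y \<and> chain_map Z X i\<^sub>Z \<and> chain_map X Y p\<^sub>Y \<and> chain_map X Z p\<^sub>Z \<and>
     E Y Y (comp_map p\<^sub>Y i\<^sub>Y) id_map \<and> E Z Z (comp_map p\<^sub>Z i\<^sub>Z) id_map \<and>
     E Z Y (comp_map p\<^sub>Y i\<^sub>Z) (zero_map Y) \<and> E Y Z (comp_map p\<^sub>Z i\<^sub>Y) (zero_map Z) \<and>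
     E X X (add_map X (comp_map i\<^sub>Y p\<^sub>Y) (comp_map i\<^sub>Z p\<^sub>Z)) id_map)"

definition indecomposable ::
  "('a::ring_1 cplx \<Rightarrow> bool) \<Rightarrow> 'a map_rel \<Rightarrow> 'a cplx \<Rightarrow> bool" where
  "indecomposable ob E X \<longleftrightarrow> ob X \<and> \<not> zero_obj E X \<and>
     (\<forall>Y Z. ob Y \<and> ob Z \<and> direct_sum E X Y Z \<longrightarrow> zero_obj E Y \<or> zero_obj E Z)"

abbreviation indecomposable_C :: "'a::ring_1 cplx \<Rightarrow> bool" where
  "indecomposable_C \<equiv> indecomposable proj_complex map_eq"

abbreviation indecomposable_Kb :: "'a::ring_1 cplx \<Rightarrow> bool" where
  "indecomposable_Kb \<equiv> indecomposable Cb homotopic"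

abbreviation contractible :: "'a::ring_1 cplx \<Rightarrow> bool" where
  "contractible \<equiv> zero_obj homotopic"


section \<open>Strong global dimension\<close>

definition reduced :: "'a::ring_1 cplx \<Rightarrow> bool" where
  "reduced X \<longleftrightarrow> Cb X \<and>
     (\<forall>Y Z. Cb Y \<and> Cb Z \<and> direct_sum map_eq X Y Z \<and> contractible Y \<longrightarrow> zero_obj map_eq Y)"

text \<open>\<open>has_length X l\<close> states \<open>\<ell>(X) = l\<close>. Since the reduced representative of a nonzero \<open>X\<close> in
  \<open>K\<^sup>b(proj \<Lambda>)\<close> exists and is unique up to isomorphism of complexes, there is exactly one such \<open>l\<close>.\<close>

definition has_length :: "'a::ring_1 cplx \<Rightarrow> nat \<Rightarrow> bool" where
  "has_length X l \<longleftrightarrow> (\<exists>X' r s. reduced X' \<and> iso_obj homotopic X X' \<and>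
     \<not> zero_module (cobj X' r) \<and> \<not> zero_module (cobj X' s) \<and>
     (\<forall>i. i < r \<or> s < i \<longrightarrow> zero_module (cobj X' i)) \<and> int l = s - r)"

definition sgldim :: "'a::ring_1 itself \<Rightarrow> enat" where
  "sgldim _ = (SUP l\<in>{l. \<exists>X :: 'a cplx. indecomposable_Kb X \<and> has_length X l}. enat l)"

definition m0_cond :: "'a::ring_1 itself \<Rightarrow> nat \<Rightarrow> bool" where
  "m0_cond _ n \<longleftrightarrow> (\<forall>X :: 'a cplx. Cn n X \<and> indecomposable_C X \<longrightarrow>
     zero_module (cobj X 1) \<or> zero_module (cobj X (int n)))"

definition m0 :: "'a::ring_1 itself \<Rightarrow> enat" where
  "m0 A = (if \<exists>n\<ge>2. m0_cond A n then enat (LEAST n. 2 \<le> n \<and> m0_cond A n) else \<infinity>)"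

end

theory Submission
  imports Defs "HOL-Library.Function_Algebras"
begin

text \<open>
  Call an indecomposable complex in \<open>C\<^sub>n\<close> with nonzero terms in degrees \<open>1\<close> and \<open>n\<close> a complex of
  width \<open>n\<close>; the condition defining \<open>m\<^sub>0\<close> says that width \<open>n\<close> does not occur. The theorem combines two
  facts.

  First, up to contractible complexes, indecomposables of width \<open>n\<close> are the reduced
  representatives, shifted to start in degree \<open>1\<close>, of indecomposables of length \<open>n - 1\<close> in the homotopy
  category. Going from the homotopy category to complexes (\<open>width_of_indecomposable_Kb\<close>), a
  decomposition of a reduced representative makes one summand contractible, hence zero. In the
  other direction (\<open>indecomposable_Kb_of_width\<close>) let \<open>X\<close> be an indecomposable complex. Fitting's lemma
  applies to it, as the terms have finite length over a finite dimensional algebra: every chain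
  endomorphism is nilpotent or invertible. An endomorphism that is idempotent up to homotopy is homotopic to
  its positive powers, so it is homotopic to zero or to the identity, and \<open>X\<close> is zero or
  indecomposable in the homotopy category. It is zero there only if it is contractible, and a contracting
  homotopy splits off the lowest term together with its image, which is impossible for width at least \<open>3\<close>.

  Second, the widths that occur have no gaps (\<open>m0_cond_Suc\<close>). Suppose that width \<open>n\<close> does not occur and
  that \<open>X\<close> has width \<open>n + 1\<close>. Cut off the last term of \<open>X\<close> and decompose what remains: every
  summand misses degree \<open>1\<close> or degree \<open>n\<close>. The last term is attached in degree \<open>n\<close> only, so the
  summands that miss degree \<open>n\<close> split off from \<open>X\<close> as well. Together they contain \<open>X\<^sup>1\<close> but not
  \<open>X\<^bsup>n+1\<^esup>\<close>, so \<open>X\<close> decomposes.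

  Hence \<open>m\<^sub>0 - 1\<close> is the supremum of the widths that occur and \<open>m\<^sub>0 - 2\<close> is the supremum of the lengths. The
  hypothesis that the strong global dimension is at least \<open>1\<close> enters at width \<open>2\<close>, which may be
  realised by contractible complexes only.

  Direct sums are handled through idempotent chain endomorphisms. An indecomposable
  complex has no idempotents but zero and the identity (\<open>indecomposable_idempotent_trivial\<close>), and the
  steps above that split a complex all consist in writing down an idempotent.
\<close>

section \<open>Modules, homomorphisms and images of idempotents\<close>

context right_module
begin

lemma zero_act [simp]: "\<zero> \<triangleleft> r = \<zero>"
proof -
  have "\<zero> \<triangleleft> r \<oplus> \<zero> \<triangleleft> r = \<zero> \<triangleleft> r"
    using act_add_left[of \<zero> \<zero> r] by simp
  then show ?thesis
    by (simp add: act_closed)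
qed

lemma act_zero [simp]: "x \<in> carrier M \<Longrightarrow> x \<triangleleft> 0 = \<zero>"
proof -
  assume x: "x \<in> carrier M"
  have "x \<triangleleft> 0 \<oplus> x \<triangleleft> 0 = x \<triangleleft> 0"
    using act_add_right[of x 0 0] x by simp
  then show ?thesis
    by (simp add: act_closed x)
qed

lemma act_minus_one: "x \<in> carrier M \<Longrightarrow> x \<triangleleft> (- 1) = \<ominus> x"
  using act_add_right[of x "- 1" 1] by (simp add: act_one act_closed minus_equality)

lemma neg_act: "x \<in> carrier M \<Longrightarrow> (\<ominus> x) \<triangleleft> r = \<ominus> (x \<triangleleft> r)"
  by (metis a_inv_closed act_closed act_minus_one act_mult mult_minus1 mult_minus1_right)

lemma minus_eq_zeroD:
  assumes "x \<ominus> y = \<zero>" "x \<in> carrier M" "y \<in> carrier M"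
  shows "x = y"
  using minus_equality[of x "\<ominus> y"] assms by (simp add: a_minus_def)

end

text \<open>The inverse is absent from the closure conditions because it is the action of \<open>-1\<close>.\<close>

definition submodule :: "('a::ring_1, 'm) rmodule \<Rightarrow> 'm set \<Rightarrow> bool" where
  "submodule M A \<longleftrightarrow> A \<subseteq> carrier M \<and> \<zero>\<^bsub>M\<^esub> \<in> A \<and>
     (\<forall>x\<in>A. \<forall>y\<in>A. x \<oplus>\<^bsub>M\<^esub> y \<in> A) \<and> (\<forall>x\<in>A. \<forall>r. x \<triangleleft>\<^bsub>M\<^esub> r \<in> A)"

lemma submodule_carrierD: "submodule M A \<Longrightarrow> x \<in> A \<Longrightarrow> x \<in> carrier M"
  and submodule_zero: "submodule M A \<Longrightarrow> \<zero>\<^bsub>M\<^esub> \<in> A"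
  and submodule_add: "submodule M A \<Longrightarrow> x \<in> A \<Longrightarrow> y \<in> A \<Longrightarrow> x \<oplus>\<^bsub>M\<^esub> y \<in> A"
  and submodule_act: "submodule M A \<Longrightarrow> x \<in> A \<Longrightarrow> x \<triangleleft>\<^bsub>M\<^esub> r \<in> A"
  by (auto simp: submodule_def)

lemma right_module_submodule:
  assumes "right_module M" "submodule M A"
  shows "right_module (M\<lparr>carrier := A\<rparr>)"
proof -
  interpret right_module M by fact
  have sub: "\<And>x. x \<in> A \<Longrightarrow> x \<in> carrier M"
    using assms(2) by (auto simp: submodule_def)
  have inv: "\<exists>y\<in>A. y \<oplus>\<^bsub>M\<^esub> x = \<zero>\<^bsub>M\<^esub>" if "x \<in> A" for x
  proof
    show "x \<triangleleft>\<^bsub>M\<^esub> (- 1) \<in> A"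
      using that assms(2) by (auto simp: submodule_def)
    show "x \<triangleleft>\<^bsub>M\<^esub> (- 1) \<oplus>\<^bsub>M\<^esub> x = \<zero>\<^bsub>M\<^esub>"
      using that by (simp add: act_minus_one sub l_neg)
  qed
  have "abelian_group (M\<lparr>carrier := A\<rparr>)"
  proof (rule abelian_groupI)
    fix x y z
    assume "x \<in> carrier (M\<lparr>carrier := A\<rparr>)" "y \<in> carrier (M\<lparr>carrier := A\<rparr>)"
      "z \<in> carrier (M\<lparr>carrier := A\<rparr>)"
    then show "x \<oplus>\<^bsub>M\<lparr>carrier := A\<rparr>\<^esub> y \<oplus>\<^bsub>M\<lparr>carrier := A\<rparr>\<^esub> z
        = x \<oplus>\<^bsub>M\<lparr>carrier := A\<rparr>\<^esub> (y \<oplus>\<^bsub>M\<lparr>carrier := A\<rparr>\<^esub> z)"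
      by (simp add: sub a_assoc)
  qed (use assms(2) inv sub in \<open>simp_all add: submodule_def a_comm\<close>)
  then show ?thesis
    by (rule right_module.intro, unfold_locales)
      (use assms(2) sub in \<open>auto simp: submodule_def act_add_left act_add_right act_mult act_one\<close>)
qed

lemma rmod_homI:
  assumes "\<And>x. x \<in> carrier M \<Longrightarrow> f x \<in> carrier N"
    "\<And>x y. x \<in> carrier M \<Longrightarrow> y \<in> carrier M \<Longrightarrow> f (x \<oplus>\<^bsub>M\<^esub> y) = f x \<oplus>\<^bsub>N\<^esub> f y"
    "\<And>x r. x \<in> carrier M \<Longrightarrow> f (x \<triangleleft>\<^bsub>M\<^esub> r) = f x \<triangleleft>\<^bsub>N\<^esub> r"
  shows "f \<in> rmod_hom M N"
  using assms by (auto simp: rmod_hom_def)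

lemma rmod_hom_closed: "f \<in> rmod_hom M N \<Longrightarrow> x \<in> carrier M \<Longrightarrow> f x \<in> carrier N"
  and rmod_hom_add: "f \<in> rmod_hom M N \<Longrightarrow> x \<in> carrier M \<Longrightarrow> y \<in> carrier M
        \<Longrightarrow> f (x \<oplus>\<^bsub>M\<^esub> y) = f x \<oplus>\<^bsub>N\<^esub> f y"
  and rmod_hom_act: "f \<in> rmod_hom M N \<Longrightarrow> x \<in> carrier M \<Longrightarrow> f (x \<triangleleft>\<^bsub>M\<^esub> r) = f x \<triangleleft>\<^bsub>N\<^esub> r"
  by (auto simp: rmod_hom_def)

lemma rmod_hom_zero:
  assumes "right_module M" "right_module N" "f \<in> rmod_hom M N"
  shows "f \<zero>\<^bsub>M\<^esub> = \<zero>\<^bsub>N\<^esub>"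
proof -
  interpret M: right_module M by fact
  interpret N: right_module N by fact
  have "f (\<zero>\<^bsub>M\<^esub> \<triangleleft>\<^bsub>M\<^esub> 0) = f \<zero>\<^bsub>M\<^esub> \<triangleleft>\<^bsub>N\<^esub> 0"
    using assms(3) by (intro rmod_hom_act) auto
  then show ?thesis
    using rmod_hom_closed[OF assms(3) M.zero_closed] by simp
qed

lemma rmod_hom_neg:
  assumes "right_module M" "right_module N" "f \<in> rmod_hom M N" "x \<in> carrier M"
  shows "f (\<ominus>\<^bsub>M\<^esub> x) = \<ominus>\<^bsub>N\<^esub> f x"
  using assms rmod_hom_act[OF assms(3,4), of "- 1"] rmod_hom_closed[OF assms(3,4)]
  by (simp add: right_module.act_minus_one)

lemma rmod_hom_minus:
  assumes "right_module M" "right_module N" "f \<in> rmod_hom M N" "x \<in> carrier M" "y \<in> carrier M"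
  shows "f (x \<ominus>\<^bsub>M\<^esub> y) = f x \<ominus>\<^bsub>N\<^esub> f y"
proof -
  interpret M: right_module M by fact
  show ?thesis
    using assms by (simp add: a_minus_def rmod_hom_add rmod_hom_neg)
qed

lemma rmod_hom_id: "(\<lambda>x. x) \<in> rmod_hom M M"
  by (simp add: rmod_hom_def)

lemma rmod_hom_comp: "f \<in> rmod_hom L M \<Longrightarrow> g \<in> rmod_hom M N \<Longrightarrow> (\<lambda>x. g (f x)) \<in> rmod_hom L N"
  by (auto simp: rmod_hom_def Pi_iff)

lemma rmod_hom_plus:
  assumes "right_module N" "f \<in> rmod_hom M N" "g \<in> rmod_hom M N"
  shows "(\<lambda>x. f x \<oplus>\<^bsub>N\<^esub> g x) \<in> rmod_hom M N"
proof -
  interpret N: right_module N by fact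
  show ?thesis
    using assms(2,3)
    by (intro rmod_homI)
      (auto simp: rmod_hom_add rmod_hom_act rmod_hom_closed N.act_add_left N.a_ac)
qed

lemma rmod_hom_uminus:
  assumes "right_module N" "f \<in> rmod_hom M N"
  shows "(\<lambda>x. \<ominus>\<^bsub>N\<^esub> f x) \<in> rmod_hom M N"
proof -
  interpret N: right_module N by fact
  show ?thesis
    using assms(2)
    by (intro rmod_homI)
      (auto simp: rmod_hom_add rmod_hom_act rmod_hom_closed N.neg_act N.minus_add)
qed

lemma rmod_hom_zero_map: "right_module N \<Longrightarrow> (\<lambda>x. \<zero>\<^bsub>N\<^esub>) \<in> rmod_hom M N"
  by (intro rmod_homI)
    (auto simp: right_module.zero_act right_module.axioms abelian_group.axioms
      abelian_monoid.zero_closed abelian_monoid.l_zero)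

lemma rmod_hom_restrict:
  assumes "f \<in> rmod_hom M N" "A \<subseteq> carrier M" "\<And>x. x \<in> A \<Longrightarrow> f x \<in> B"
  shows "f \<in> rmod_hom (M\<lparr>carrier := A\<rparr>) (N\<lparr>carrier := B\<rparr>)"
  using assms by (auto simp: rmod_hom_def Pi_iff subset_iff)

lemma submodule_image:
  assumes "right_module M" "right_module N" "f \<in> rmod_hom M N" "submodule M A"
  shows "submodule N (f ` A)"
proof -
  have sub: "\<And>x. x \<in> A \<Longrightarrow> x \<in> carrier M"
    using assms(4) by (auto simp: submodule_def)
  show ?thesis
    unfolding submodule_def
  proof (intro conjI ballI allI)
    show "f ` A \<subseteq> carrier N"
      using sub rmod_hom_closed[OF assms(3)] by auto
    show "\<zero>\<^bsub>N\<^esub> \<in> f ` A"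
      using rmod_hom_zero[OF assms(1-3)] assms(4) by (intro image_eqI[of _ _ "\<zero>\<^bsub>M\<^esub>"]) (auto simp: submodule_def)
    fix x y r
    assume "x \<in> f ` A"
    then obtain a where a: "a \<in> A" "x = f a" by auto
    then show "x \<triangleleft>\<^bsub>N\<^esub> r \<in> f ` A"
      using rmod_hom_act[OF assms(3) sub] assms(4) by (metis imageI submodule_def)
    assume "y \<in> f ` A"
    then obtain b where "b \<in> A" "y = f b" by auto
    then show "x \<oplus>\<^bsub>N\<^esub> y \<in> f ` A"
      using a rmod_hom_add[OF assms(3) sub sub] assms(4) by (metis imageI submodule_def)
  qed
qed

lemma submodule_carrier: "right_module M \<Longrightarrow> submodule M (carrier M)"
  by (simp add: submodule_def right_module.act_closed right_module.axioms abelian_group.axioms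
      abelian_monoid.zero_closed abelian_monoid.a_closed)

lemma finsum_in_submodule:
  assumes "right_module M" "submodule M A" "finite S" "\<And>s. s \<in> S \<Longrightarrow> g s \<in> A"
  shows "(\<Oplus>\<^bsub>M\<^esub>s\<in>S. g s) \<in> A"
proof -
  interpret right_module M by fact
  have sub: "\<And>x. x \<in> A \<Longrightarrow> x \<in> carrier M"
    using assms(2) by (auto simp: submodule_def)
  show ?thesis
    using assms(3,4)
  proof (induction S rule: finite_induct)
    case empty
    then show ?case using assms(2) by (simp add: submodule_def)
  next
    case (insert s S)
    then show ?case using assms(2) sub by (simp add: submodule_def Pi_iff)
  qed
qed

lemma rmod_hom_finsum:
  assumes "right_module M" "right_module N" "f \<in> rmod_hom M N" "finite S"
    and "\<And>s. s \<in> S \<Longrightarrow> g s \<in> carrier M"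
  shows "f (\<Oplus>\<^bsub>M\<^esub>s\<in>S. g s) = (\<Oplus>\<^bsub>N\<^esub>s\<in>S. f (g s))"
proof -
  interpret M: right_module M by fact
  interpret N: right_module N by fact
  show ?thesis
    using assms(4,5)
  proof (induction S rule: finite_induct)
    case empty
    then show ?case using rmod_hom_zero[OF assms(1-3)] by simp
  next
    case (insert s S)
    have "(\<Oplus>\<^bsub>M\<^esub>s\<in>S. g s) \<in> carrier M"
      using insert.prems by (intro M.finsum_closed) auto
    then show ?case
      using insert rmod_hom_closed[OF assms(3)] by (simp add: Pi_iff rmod_hom_add[OF assms(3)])
  qed
qed

text \<open>Evaluation of a coordinate vector at a finite family of module elements; it is the map
  \<open>\<Lambda>\<^sup>S \<rightarrow> M\<close> that sends the basis vector of \<open>s\<close> to \<open>s\<close>.\<close>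

definition lincomb :: "('a::ring_1, 'm) rmodule \<Rightarrow> 'm set \<Rightarrow> ('m \<Rightarrow> 'a) \<Rightarrow> 'm" where
  "lincomb M S c = (\<Oplus>\<^bsub>M\<^esub>s\<in>S. s \<triangleleft>\<^bsub>M\<^esub> c s)"

context right_module
begin

lemma lincomb_closed: "S \<subseteq> carrier M \<Longrightarrow> lincomb M S c \<in> carrier M"
  unfolding lincomb_def by (rule finsum_closed) (auto simp: act_closed)

lemma lincomb_cong:
  assumes "S \<subseteq> carrier M" "\<And>s. s \<in> S \<Longrightarrow> c s = c' s"
  shows "lincomb M S c = lincomb M S c'"
  unfolding lincomb_def using assms by (intro finsum_cong') (auto simp: act_closed)

lemma lincomb_zero: "finite S \<Longrightarrow> S \<subseteq> carrier M \<Longrightarrow> lincomb M S (\<lambda>s. 0) = \<zero>"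
  unfolding lincomb_def using finsum_cong'[of S S "\<lambda>s. \<zero>" "\<lambda>s. s \<triangleleft> 0"] by (auto simp: subset_iff)

lemma lincomb_add:
  assumes "S \<subseteq> carrier M"
  shows "lincomb M S (\<lambda>s. c s + c' s) = lincomb M S c \<oplus> lincomb M S c'"
proof -
  have "lincomb M S (\<lambda>s. c s + c' s) = (\<Oplus>s\<in>S. s \<triangleleft> c s \<oplus> s \<triangleleft> c' s)"
    unfolding lincomb_def using assms
    by (intro finsum_cong') (auto simp: act_closed act_add_right subset_iff)
  also have "\<dots> = lincomb M S c \<oplus> lincomb M S c'"
    unfolding lincomb_def using assms by (intro finsum_addf) (auto simp: act_closed)
  finally show ?thesis .
qed

lemma lincomb_mult:
  assumes "finite S" "S \<subseteq> carrier M"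
  shows "lincomb M S (\<lambda>s. c s * r) = lincomb M S c \<triangleleft> r"
  using assms
proof (induction S rule: finite_induct)
  case empty
  then show ?case by (simp add: lincomb_def)
next
  case (insert s S)
  have "lincomb M S c \<in> carrier M"
    using insert.prems by (intro lincomb_closed) auto
  moreover have "lincomb M (insert s S) d = s \<triangleleft> d s \<oplus> lincomb M S d" for d
    using insert unfolding lincomb_def by (subst finsum_insert) (auto simp: act_closed subset_iff)
  ultimately show ?case
    using insert by (simp add: act_add_left act_closed act_mult)
qed

lemma lincomb_single:
  assumes "finite S" "S \<subseteq> carrier M" "t \<in> S"
  shows "lincomb M S (\<lambda>s. if s = t then 1 else 0) = t"
proof -
  have "lincomb M S (\<lambda>s. if s = t then 1 else 0) = (\<Oplus>s\<in>S. if t = s then s else \<zero>)"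
    unfolding lincomb_def using assms by (intro finsum_cong') (auto simp: act_one subset_iff)
  also have "\<dots> = t"
    using assms by (subst finsum_singleton[of t S "\<lambda>x. x"]) auto
  finally show ?thesis .
qed

lemma submodule_lincomb:
  assumes "finite S" "S \<subseteq> carrier M"
  shows "submodule M (range (lincomb M S))"
  unfolding submodule_def
proof (intro conjI ballI allI)
  show "range (lincomb M S) \<subseteq> carrier M"
    using lincomb_closed assms by auto
  show "\<zero> \<in> range (lincomb M S)"
    using lincomb_zero[OF assms] by (metis rangeI)
  fix x y r
  assume "x \<in> range (lincomb M S)"
  then obtain c where c: "x = lincomb M S c" by auto
  show "x \<triangleleft> r \<in> range (lincomb M S)"
    unfolding c lincomb_mult[OF assms, symmetric] by (rule rangeI)
  assume "y \<in> range (lincomb M S)"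
  then obtain c' where c': "y = lincomb M S c'" by auto
  show "x \<oplus> y \<in> range (lincomb M S)"
    unfolding c c' lincomb_add[OF assms(2), symmetric] by (rule rangeI)
qed

end

lemma finitely_generated_iff:
  "finitely_generated M \<longleftrightarrow>
     (\<exists>S. finite S \<and> S \<subseteq> carrier M \<and> (\<forall>x\<in>carrier M. \<exists>c. x = lincomb M S c))"
  by (simp add: finitely_generated_def lincomb_def)


text \<open>The images of the generators generate. Since \<open>f\<close> may identify generators, the coefficients of
  \<open>x\<close> are not coefficients of \<open>f x\<close>; the argument uses instead that the linear combinations of
  \<open>f ` S\<close> form a submodule, which contains every summand of \<open>f x\<close>.\<close>

lemma finitely_generated_image:
  assumes "right_module M" "right_module N" "f \<in> rmod_hom M N" "f ` carrier M = carrier N"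
    and "finitely_generated M"
  shows "finitely_generated N"
proof -
  interpret M: right_module M by fact
  interpret N: right_module N by fact
  obtain S where S: "finite S" "S \<subseteq> carrier M" "\<And>x. x \<in> carrier M \<Longrightarrow> \<exists>c. x = lincomb M S c"
    using assms(5) by (auto simp: finitely_generated_iff)
  have T: "finite (f ` S)" "f ` S \<subseteq> carrier N"
    using S assms(4) by auto
  have "y \<in> range (lincomb N (f ` S))" if "y \<in> carrier N" for y
  proof -
    obtain x where x: "x \<in> carrier M" "y = f x"
      using \<open>y \<in> carrier N\<close> unfolding assms(4)[symmetric] by (auto elim: imageE)
    then obtain c where c: "x = lincomb M S c"
      using S(3) by blast
    have "y = (\<Oplus>\<^bsub>N\<^esub>s\<in>S. f (s \<triangleleft>\<^bsub>M\<^esub> c s))"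
      unfolding x(2) c lincomb_def using S M.act_closed
      by (intro rmod_hom_finsum[OF assms(1-3)]) auto
    also have "\<dots> \<in> range (lincomb N (f ` S))"
    proof (rule finsum_in_submodule[OF assms(2) N.submodule_lincomb[OF T] S(1)])
      fix s assume s: "s \<in> S"
      have "f s \<in> range (lincomb N (f ` S))"
        by (rule range_eqI) (rule N.lincomb_single[OF T imageI[OF s], symmetric])
      then show "f (s \<triangleleft>\<^bsub>M\<^esub> c s) \<in> range (lincomb N (f ` S))"
        using N.submodule_lincomb[OF T] s S(2)
        by (subst rmod_hom_act[OF assms(3)]) (blast, rule submodule_act)
    qed
    finally show ?thesis .
  qed
  then have "\<forall>y\<in>carrier N. \<exists>c. y = lincomb N (f ` S) c"
    by auto
  then show ?thesis
    unfolding finitely_generated_iff using T by (intro exI[of _ "f ` S"] conjI)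
qed

lemma proj_module_right_module: "proj_module P \<Longrightarrow> right_module P"
  by (simp add: proj_module_def)

text \<open>A direct summand of a projective module is projective: a map out of the image of \<open>e\<close> is lifted
  by lifting its composite with \<open>e\<close> and restricting. The summand is kept inside the given module by
  changing the carrier only.\<close>

lemma proj_module_idempotent_image:
  assumes P: "proj_module P" and e: "e \<in> rmod_hom P P"
    and idem: "\<And>x. x \<in> carrier P \<Longrightarrow> e (e x) = e x"
  shows "proj_module (P\<lparr>carrier := e ` carrier P\<rparr>)" (is "proj_module ?Q")
proof -
  have rP: "right_module P"
    using P by (rule proj_module_right_module)
  have sub: "submodule P (e ` carrier P)"
    by (rule submodule_image[OF rP rP e submodule_carrier[OF rP]])
  then have rQ: "right_module ?Q"
    by (rule right_module_submodule[OF rP])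
  have inc: "e ` carrier P \<subseteq> carrier P"
    using sub by (simp add: submodule_def)
  have eQ: "e \<in> rmod_hom P ?Q"
    using rmod_hom_restrict[OF e, of "carrier P" "e ` carrier P"] by auto
  have projP: "projective P" and "finitely_generated P"
    using P by (auto simp: proj_module_def)
  then have "finitely_generated ?Q"
    using eQ by (intro finitely_generated_image[OF rP rQ]) auto
  moreover have "projective ?Q"
    unfolding projective_def
  proof (intro allI impI, elim conjE)
    fix M N :: "'a rmod" and p f
    assume M: "right_module M" and N: "right_module N" and p: "p \<in> rmod_hom M N"
      "p ` carrier M = carrier N" and f: "f \<in> rmod_hom ?Q N"
    have "(\<lambda>x. f (e x)) \<in> rmod_hom P N"
      by (rule rmod_hom_comp[OF eQ f])
    then obtain g where g: "g \<in> rmod_hom P M" "\<forall>x\<in>carrier P. p (g x) = f (e x)"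
      using projP[unfolded projective_def, rule_format, of M N p "\<lambda>x. f (e x)"] M N p
      by auto
    have "g \<in> rmod_hom ?Q M"
      using rmod_hom_restrict[OF g(1) inc, of "carrier M"] rmod_hom_closed[OF g(1)] inc by auto
    then show "\<exists>g\<in>rmod_hom ?Q M. \<forall>x\<in>carrier ?Q. p (g x) = f x"
      using g(2) idem inc by (intro bexI[of _ g]) auto
  qed
  ultimately show ?thesis
    using rQ by (simp add: proj_module_def)
qed

lemma proj_module_zero:
  assumes "proj_module P"
  shows "proj_module (P\<lparr>carrier := {\<zero>\<^bsub>P\<^esub>}\<rparr>)"
proof -
  interpret right_module P using assms by (rule proj_module_right_module)
  have "(\<lambda>x. \<zero>\<^bsub>P\<^esub>) ` carrier P = {\<zero>\<^bsub>P\<^esub>}"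
    by (auto simp: image_constant_conv)
  moreover have "proj_module (P\<lparr>carrier := (\<lambda>x. \<zero>\<^bsub>P\<^esub>) ` carrier P\<rparr>)"
    by (rule proj_module_idempotent_image[OF assms rmod_hom_zero_map[OF right_module_axioms]]) simp
  ultimately show ?thesis
    by simp
qed

section \<open>Complexes, homotopies and idempotent chain endomorphisms\<close>

lemma proj_complex_module: "proj_complex X \<Longrightarrow> right_module (cobj X i)"
  by (simp add: proj_complex_def proj_module_right_module)

lemma cdiff_hom: "proj_complex X \<Longrightarrow> cdiff X i \<in> rmod_hom (cobj X i) (cobj X (i + 1))"
  by (simp add: proj_complex_def)

lemma cdiff_hom_pred: "proj_complex X \<Longrightarrow> cdiff X (i - 1) \<in> rmod_hom (cobj X (i - 1)) (cobj X i)"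
  using cdiff_hom[of X "i - 1"] by simp

lemma cdiff_closed: "proj_complex X \<Longrightarrow> x \<in> carrier (cobj X i) \<Longrightarrow> cdiff X i x \<in> carrier (cobj X (i + 1))"
  by (rule rmod_hom_closed[OF cdiff_hom])

lemma cdiff_cdiff: "proj_complex X \<Longrightarrow> x \<in> carrier (cobj X i)
    \<Longrightarrow> cdiff X (i + 1) (cdiff X i x) = \<zero>\<^bsub>cobj X (i + 2)\<^esub>"
  by (simp add: proj_complex_def)

lemma cobj_zero_closed: "proj_complex X \<Longrightarrow> \<zero>\<^bsub>cobj X i\<^esub> \<in> carrier (cobj X i)"
  by (rule submodule_zero[OF submodule_carrier[OF proj_complex_module]])

lemma cdiff_zero: "proj_complex X \<Longrightarrow> cdiff X i \<zero>\<^bsub>cobj X i\<^esub> = \<zero>\<^bsub>cobj X (i + 1)\<^esub>"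
  by (rule rmod_hom_zero[OF proj_complex_module proj_complex_module cdiff_hom])

lemma chain_mapI:
  assumes "\<And>i. f i \<in> rmod_hom (cobj X i) (cobj Y i)"
    "\<And>i x. x \<in> carrier (cobj X i) \<Longrightarrow> cdiff Y i (f i x) = f (i + 1) (cdiff X i x)"
  shows "chain_map X Y f"
  using assms by (simp add: chain_map_def)

lemma chain_map_hom: "chain_map X Y f \<Longrightarrow> f i \<in> rmod_hom (cobj X i) (cobj Y i)"
  and chain_map_comm: "chain_map X Y f \<Longrightarrow> x \<in> carrier (cobj X i)
        \<Longrightarrow> cdiff Y i (f i x) = f (i + 1) (cdiff X i x)"
  by (simp_all add: chain_map_def)

lemma chain_map_closed: "chain_map X Y f \<Longrightarrow> x \<in> carrier (cobj X i) \<Longrightarrow> f i x \<in> carrier (cobj Y i)"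
  by (rule rmod_hom_closed[OF chain_map_hom])

lemma chain_map_zero:
  "proj_complex X \<Longrightarrow> proj_complex Y \<Longrightarrow> chain_map X Y f \<Longrightarrow> f i \<zero>\<^bsub>cobj X i\<^esub> = \<zero>\<^bsub>cobj Y i\<^esub>"
  by (rule rmod_hom_zero[OF proj_complex_module proj_complex_module chain_map_hom])

lemma chain_map_add:
  "chain_map X Y f \<Longrightarrow> x \<in> carrier (cobj X i) \<Longrightarrow> y \<in> carrier (cobj X i)
    \<Longrightarrow> f i (x \<oplus>\<^bsub>cobj X i\<^esub> y) = f i x \<oplus>\<^bsub>cobj Y i\<^esub> f i y"
  by (rule rmod_hom_add[OF chain_map_hom])

lemma chain_map_minus:
  "proj_complex X \<Longrightarrow> proj_complex Y \<Longrightarrow> chain_map X Y f \<Longrightarrow> x \<in> carrier (cobj X i)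
    \<Longrightarrow> y \<in> carrier (cobj X i) \<Longrightarrow> f i (x \<ominus>\<^bsub>cobj X i\<^esub> y) = f i x \<ominus>\<^bsub>cobj Y i\<^esub> f i y"
  by (rule rmod_hom_minus[OF proj_complex_module proj_complex_module chain_map_hom])

lemma chain_map_id: "chain_map X X id_map"
  by (simp add: chain_map_def id_map_def rmod_hom_id)

lemma chain_map_zero_map: "proj_complex X \<Longrightarrow> proj_complex Y \<Longrightarrow> chain_map X Y (zero_map Y)"
  by (intro chain_mapI)
    (auto simp: zero_map_def rmod_hom_zero_map proj_complex_module cdiff_zero)

lemma chain_map_comp:
  assumes "chain_map X Y f" "chain_map Y Z g"
  shows "chain_map X Z (comp_map g f)"
  unfolding comp_map_def
proof (rule chain_mapI)
  show "(\<lambda>x. g i (f i x)) \<in> rmod_hom (cobj X i) (cobj Z i)" for i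
    by (rule rmod_hom_comp[OF chain_map_hom[OF assms(1)] chain_map_hom[OF assms(2)]])
  show "cdiff Z i (g i (f i x)) = g (i + 1) (f (i + 1) (cdiff X i x))"
    if "x \<in> carrier (cobj X i)" for i x
    by (simp add: chain_map_comm[OF assms(2) chain_map_closed[OF assms(1) that]]
        chain_map_comm[OF assms(1) that])
qed

lemma chain_map_add_map:
  assumes "proj_complex Y" "chain_map X Y f" "chain_map X Y g"
  shows "chain_map X Y (add_map Y f g)"
  unfolding add_map_def
  by (intro chain_mapI rmod_hom_plus)
    (simp_all add: assms proj_complex_module chain_map_hom chain_map_comm[OF assms(2), symmetric]
      chain_map_comm[OF assms(3), symmetric] chain_map_closed[OF assms(2)]
      chain_map_closed[OF assms(3)] rmod_hom_add[OF cdiff_hom[OF assms(1)]])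

lemma zero_obj_iff: "proj_complex X \<Longrightarrow> zero_obj map_eq X \<longleftrightarrow> (\<forall>i. zero_module (cobj X i))"
  using cobj_zero_closed[of X]
  by (auto simp: zero_obj_def map_eq_def id_map_def zero_map_def zero_module_def)

subsection \<open>Splitting idempotents\<close>

definition image_cplx :: "'a::ring_1 cplx \<Rightarrow> 'a cmap \<Rightarrow> 'a cplx" where
  "image_cplx X e = \<lparr>cobj = \<lambda>i. (cobj X i)\<lparr>carrier := e i ` carrier (cobj X i)\<rparr>, cdiff = cdiff X\<rparr>"

definition idempotent :: "'a::ring_1 cplx \<Rightarrow> 'a cmap \<Rightarrow> bool" where
  "idempotent X e \<longleftrightarrow> chain_map X X e \<and> (\<forall>i. \<forall>x\<in>carrier (cobj X i). e i (e i x) = e i x)"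

lemma image_cplx_simps [simp]:
  "carrier (cobj (image_cplx X e) i) = e i ` carrier (cobj X i)"
  "\<zero>\<^bsub>cobj (image_cplx X e) i\<^esub> = \<zero>\<^bsub>cobj X i\<^esub>"
  "x \<oplus>\<^bsub>cobj (image_cplx X e) i\<^esub> y = x \<oplus>\<^bsub>cobj X i\<^esub> y"
  "cdiff (image_cplx X e) = cdiff X"
  by (simp_all add: image_cplx_def)

lemma image_cplx_subset:
  "chain_map X X e \<Longrightarrow> y \<in> e i ` carrier (cobj X i) \<Longrightarrow> y \<in> carrier (cobj X i)"
  using chain_map_closed by auto

context
  fixes X :: "'a::ring_1 cplx" and e
  assumes X: "proj_complex X" and e: "idempotent X e"
begin

private lemma chain: "chain_map X X e"
  using e by (simp add: idempotent_def)

private lemma cdiff_image: "y \<in> e i ` carrier (cobj X i) \<Longrightarrow> cdiff X i y \<in> e (i + 1) ` carrier (cobj X (i + 1))"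
  using chain_map_comm[OF chain] cdiff_closed[OF X] by auto

lemma proj_complex_image_cplx: "proj_complex (image_cplx X e)"
  unfolding proj_complex_def
proof (intro conjI allI ballI)
  fix i
  show "proj_module (cobj (image_cplx X e) i)"
    using proj_module_idempotent_image[OF _ chain_map_hom[OF chain]] X e
    by (simp add: image_cplx_def proj_complex_def idempotent_def)
  show "cdiff (image_cplx X e) i \<in> rmod_hom (cobj (image_cplx X e) i) (cobj (image_cplx X e) (i + 1))"
    unfolding image_cplx_def cplx.simps
    using image_cplx_subset[OF chain] cdiff_image by (intro rmod_hom_restrict[OF cdiff_hom[OF X]]) auto
  fix x assume "x \<in> carrier (cobj (image_cplx X e) i)"
  then show "cdiff (image_cplx X e) (i + 1) (cdiff (image_cplx X e) i x)
      = \<zero>\<^bsub>cobj (image_cplx X e) (i + 2)\<^esub>"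
    using cdiff_cdiff[OF X] image_cplx_subset[OF chain] by simp
qed

lemma chain_map_inclusion: "chain_map (image_cplx X e) X id_map"
  using image_cplx_subset[OF chain]
  by (auto simp: chain_map_def id_map_def rmod_hom_def image_cplx_def)

lemma chain_map_projection: "chain_map X (image_cplx X e) e"
proof (rule chain_mapI)
  fix i
  show "e i \<in> rmod_hom (cobj X i) (cobj (image_cplx X e) i)"
    using rmod_hom_restrict[OF chain_map_hom[OF chain], of "carrier (cobj X i)" i "e i ` carrier (cobj X i)"]
    by (simp add: image_cplx_def)
qed (simp add: chain_map_comm[OF chain])

end

definition complement :: "'a::ring_1 cplx \<Rightarrow> 'a cmap \<Rightarrow> 'a cmap" where
  "complement X e = (\<lambda>i x. x \<ominus>\<^bsub>cobj X i\<^esub> e i x)"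

lemma idempotent_complement:
  assumes X: "proj_complex X" and e: "idempotent X e"
  shows "idempotent X (complement X e)"
    and "x \<in> carrier (cobj X i) \<Longrightarrow> e i (complement X e i x) = \<zero>\<^bsub>cobj X i\<^esub>"
    and "x \<in> carrier (cobj X i) \<Longrightarrow> complement X e i (e i x) = \<zero>\<^bsub>cobj X i\<^esub>"
    and "x \<in> carrier (cobj X i) \<Longrightarrow> e i x \<oplus>\<^bsub>cobj X i\<^esub> complement X e i x = x"
proof -
  interpret right_module "cobj X i" for i
    by (rule proj_complex_module[OF X])
  have ch: "chain_map X X e" and id: "\<And>i x. x \<in> carrier (cobj X i) \<Longrightarrow> e i (e i x) = e i x"
    using e by (auto simp: idempotent_def)
  note cl = chain_map_closed[OF ch]
  have minus_self: "x \<ominus>\<^bsub>cobj X i\<^esub> x = \<zero>\<^bsub>cobj X i\<^esub>" if "x \<in> carrier (cobj X i)" for i x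
    using that by (simp add: a_minus_def r_neg)
  have chc: "chain_map X X (complement X e)"
    unfolding complement_def
  proof (rule chain_mapI)
    show "(\<lambda>x. x \<ominus>\<^bsub>cobj X i\<^esub> e i x) \<in> rmod_hom (cobj X i) (cobj X i)" for i
      unfolding a_minus_def
      by (intro rmod_hom_plus rmod_hom_uminus rmod_hom_id chain_map_hom[OF ch] proj_complex_module[OF X])
    show "cdiff X i (x \<ominus>\<^bsub>cobj X i\<^esub> e i x)
        = cdiff X i x \<ominus>\<^bsub>cobj X (i + 1)\<^esub> e (i + 1) (cdiff X i x)"
      if "x \<in> carrier (cobj X i)" for i x
      using rmod_hom_minus[OF proj_complex_module[OF X] proj_complex_module[OF X] cdiff_hom[OF X] that cl[OF that]]
      by (simp add: chain_map_comm[OF ch that])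
  qed
  show ec: "e i (complement X e i x) = \<zero>\<^bsub>cobj X i\<^esub>" if "x \<in> carrier (cobj X i)" for i x
    using that chain_map_minus[OF X X ch that cl[OF that]] by (simp add: complement_def id cl minus_self)
  show "complement X e i (e i x) = \<zero>\<^bsub>cobj X i\<^esub>" if "x \<in> carrier (cobj X i)" for i x
    using that by (simp add: complement_def id cl minus_self)
  show "e i x \<oplus>\<^bsub>cobj X i\<^esub> complement X e i x = x" if "x \<in> carrier (cobj X i)" for i x
    using that cl[OF that] by (simp add: complement_def a_minus_def a_lcomm[of "e i x"] r_neg)
  have "complement X e i (complement X e i x) = complement X e i x" if "x \<in> carrier (cobj X i)" for i x
    using ec[OF that] chain_map_closed[OF chc that]
    by (simp add: complement_def[of X e] a_minus_def)
  then show "idempotent X (complement X e)"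
    using chc by (simp add: idempotent_def)
qed

lemma direct_sum_image_complement:
  assumes X: "proj_complex X" and e: "idempotent X e"
  shows "direct_sum map_eq X (image_cplx X e) (image_cplx X (complement X e))"
  unfolding direct_sum_def
proof (intro exI conjI)
  note c = idempotent_complement[OF X e]
  show "chain_map (image_cplx X e) X id_map" "chain_map X (image_cplx X e) e"
    by (rule chain_map_inclusion[OF X e] chain_map_projection[OF X e])+
  show "chain_map (image_cplx X (complement X e)) X id_map"
    "chain_map X (image_cplx X (complement X e)) (complement X e)"
    by (rule chain_map_inclusion[OF X c(1)] chain_map_projection[OF X c(1)])+
  have id: "\<And>i x. x \<in> carrier (cobj X i) \<Longrightarrow> e i (e i x) = e i x"
    "\<And>i x. x \<in> carrier (cobj X i) \<Longrightarrow> complement X e i (complement X e i x) = complement X e i x"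
    using e c(1) by (simp_all add: idempotent_def)
  show "map_eq (image_cplx X e) (image_cplx X e) (comp_map e id_map) id_map"
    "map_eq (image_cplx X (complement X e)) (image_cplx X (complement X e))
      (comp_map (complement X e) id_map) id_map"
    using id by (auto simp: map_eq_def comp_map_def id_map_def)
  show "map_eq (image_cplx X (complement X e)) (image_cplx X e) (comp_map e id_map)
      (zero_map (image_cplx X e))"
    "map_eq (image_cplx X e) (image_cplx X (complement X e)) (comp_map (complement X e) id_map)
      (zero_map (image_cplx X (complement X e)))"
    using c(2,3) by (auto simp: map_eq_def comp_map_def id_map_def zero_map_def)
  show "map_eq X X (add_map X (comp_map id_map e) (comp_map id_map (complement X e))) id_map"
    using c(4) by (simp add: map_eq_def comp_map_def id_map_def add_map_def)
qed

lemma indecomposableD: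
  "indecomposable ob E X \<Longrightarrow> ob Y \<Longrightarrow> ob Z \<Longrightarrow> direct_sum E X Y Z \<Longrightarrow> zero_obj E Y \<or> zero_obj E Z"
  by (simp add: indecomposable_def)

text \<open>An idempotent endomorphism splits off its image, and its image and the image of its
  complement cannot both be nonzero.\<close>

lemma indecomposable_idempotent_trivial:
  assumes "indecomposable_C X" "idempotent X e"
  shows "(\<forall>i. \<forall>x\<in>carrier (cobj X i). e i x = \<zero>\<^bsub>cobj X i\<^esub>)
    \<or> (\<forall>i. \<forall>x\<in>carrier (cobj X i). e i x = x)"
proof -
  have X: "proj_complex X"
    using assms(1) by (simp add: indecomposable_def)
  interpret right_module "cobj X i" for i
    by (rule proj_complex_module[OF X])
  note c = idempotent_complement[OF X assms(2)]
  let ?Y = "image_cplx X e" and ?Z = "image_cplx X (complement X e)"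
  have "zero_obj map_eq ?Y \<or> zero_obj map_eq ?Z"
    using assms(1) direct_sum_image_complement[OF X assms(2)]
      proj_complex_image_cplx[OF X assms(2)] proj_complex_image_cplx[OF X c(1)]
    by (intro indecomposableD)
  moreover have "\<forall>i. \<forall>x\<in>carrier (cobj X i). e i x = \<zero>\<^bsub>cobj X i\<^esub>" if "zero_obj map_eq ?Y"
    using that by (auto simp: zero_obj_def map_eq_def id_map_def zero_map_def)
  moreover have "\<forall>i. \<forall>x\<in>carrier (cobj X i). e i x = x" if "zero_obj map_eq ?Z"
  proof (intro allI ballI)
    fix i x assume x: "x \<in> carrier (cobj X i)"
    then have "complement X e i x = \<zero>\<^bsub>cobj X i\<^esub>"
      using that by (auto simp: zero_obj_def map_eq_def id_map_def zero_map_def)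
    then show "e i x = x"
      using c(4)[OF x] x assms(2) chain_map_closed[of X X e x i] by (simp add: idempotent_def)
  qed
  ultimately show ?thesis by blast
qed

subsection \<open>Homotopy is a congruence\<close>

text \<open>Writing \<open>d h + h d\<close> as one function keeps the index shift \<open>(i + 1) - 1 = i\<close> out of calculations
  with homotopies.\<close>

definition htpy_sum :: "'a::ring_1 cplx \<Rightarrow> 'a cplx \<Rightarrow> 'a cmap \<Rightarrow> 'a cmap" where
  "htpy_sum X Y h = (\<lambda>i x. cdiff Y (i - 1) (h i x) \<oplus>\<^bsub>cobj Y i\<^esub> h (i + 1) (cdiff X i x))"

definition htpy :: "'a::ring_1 cplx \<Rightarrow> 'a cplx \<Rightarrow> 'a cmap \<Rightarrow> bool" where
  "htpy X Y h \<longleftrightarrow> (\<forall>i. h i \<in> rmod_hom (cobj X i) (cobj Y (i - 1)))"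

lemma homotopic_iff:
  "homotopic X Y f g \<longleftrightarrow> (\<exists>h. htpy X Y h \<and>
     (\<forall>i. \<forall>x\<in>carrier (cobj X i). f i x = g i x \<oplus>\<^bsub>cobj Y i\<^esub> htpy_sum X Y h i x))"
  by (simp add: homotopic_def htpy_def htpy_sum_def)

lemma htpy_hom: "htpy X Y h \<Longrightarrow> h i \<in> rmod_hom (cobj X i) (cobj Y (i - 1))"
  by (simp add: htpy_def)

lemma htpy_hom_succ: "htpy X Y h \<Longrightarrow> h (i + 1) \<in> rmod_hom (cobj X (i + 1)) (cobj Y i)"
  using htpy_hom[of X Y h "i + 1"] by simp

lemma htpy_sum_closed1:
  assumes "proj_complex X" "proj_complex Y" "htpy X Y h" "x \<in> carrier (cobj X i)"
  shows "cdiff Y (i - 1) (h i x) \<in> carrier (cobj Y i)"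
    and "h (i + 1) (cdiff X i x) \<in> carrier (cobj Y i)"
  by (rule rmod_hom_closed[OF cdiff_hom_pred[OF assms(2)] rmod_hom_closed[OF htpy_hom[OF assms(3)] assms(4)]]
      rmod_hom_closed[OF htpy_hom_succ[OF assms(3)] cdiff_closed[OF assms(1,4)]])+

lemma htpy_sum_closed:
  assumes "proj_complex X" "proj_complex Y" "htpy X Y h" "x \<in> carrier (cobj X i)"
  shows "htpy_sum X Y h i x \<in> carrier (cobj Y i)"
  unfolding htpy_sum_def
  by (rule submodule_add[OF submodule_carrier[OF proj_complex_module[OF assms(2)]] htpy_sum_closed1[OF assms]])

lemma homotopicI_map_eq:
  assumes X: "proj_complex X" and Y: "proj_complex Y" and g: "chain_map X Y g" and eq: "map_eq X Y f g"
  shows "homotopic X Y f g"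
  unfolding homotopic_iff
proof (intro exI conjI allI ballI)
  interpret Y: right_module "cobj Y i" for i
    by (rule proj_complex_module[OF Y])
  show "htpy X Y (\<lambda>i x. \<zero>\<^bsub>cobj Y (i - 1)\<^esub>)"
    by (simp add: htpy_def rmod_hom_zero_map proj_complex_module[OF Y])
  fix i x assume x: "x \<in> carrier (cobj X i)"
  have "htpy_sum X Y (\<lambda>i x. \<zero>\<^bsub>cobj Y (i - 1)\<^esub>) i x = \<zero>\<^bsub>cobj Y i\<^esub>"
    using cdiff_zero[OF Y, of "i - 1"] by (simp add: htpy_sum_def)
  then show "f i x = g i x \<oplus>\<^bsub>cobj Y i\<^esub> htpy_sum X Y (\<lambda>i x. \<zero>\<^bsub>cobj Y (i - 1)\<^esub>) i x"
    using eq x chain_map_closed[OF g x] by (simp add: map_eq_def)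
qed

lemma homotopic_refl: "proj_complex X \<Longrightarrow> proj_complex Y \<Longrightarrow> chain_map X Y f \<Longrightarrow> homotopic X Y f f"
  by (rule homotopicI_map_eq) (simp_all add: map_eq_def)

lemma homotopic_sym:
  assumes X: "proj_complex X" and Y: "proj_complex Y" and g: "chain_map X Y g" and fg: "homotopic X Y f g"
  shows "homotopic X Y g f"
proof -
  interpret Y: right_module "cobj Y i" for i
    by (rule proj_complex_module[OF Y])
  obtain h where h: "htpy X Y h"
    and eq: "\<And>i x. x \<in> carrier (cobj X i) \<Longrightarrow> f i x = g i x \<oplus>\<^bsub>cobj Y i\<^esub> htpy_sum X Y h i x"
    using fg by (auto simp: homotopic_iff)
  let ?h = "\<lambda>i x. \<ominus>\<^bsub>cobj Y (i - 1)\<^esub> h i x"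
  have h': "htpy X Y ?h"
    using h by (simp add: htpy_def rmod_hom_uminus proj_complex_module[OF Y])
  show ?thesis
    unfolding homotopic_iff
  proof (intro exI conjI allI ballI)
    show "htpy X Y ?h" by (rule h')
    fix i x assume x: "x \<in> carrier (cobj X i)"
    have "htpy_sum X Y ?h i x = \<ominus>\<^bsub>cobj Y i\<^esub> htpy_sum X Y h i x"
      using rmod_hom_neg[OF proj_complex_module[OF Y] proj_complex_module[OF Y] cdiff_hom_pred[OF Y]
          rmod_hom_closed[OF htpy_hom[OF h] x]] htpy_sum_closed1[OF X Y h x]
      by (simp add: htpy_sum_def Y.minus_add)
    then show "g i x = f i x \<oplus>\<^bsub>cobj Y i\<^esub> htpy_sum X Y ?h i x"
      using eq[OF x] htpy_sum_closed[OF X Y h x] chain_map_closed[OF g x]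
      by (simp add: Y.a_assoc Y.r_neg)
  qed
qed

lemma homotopic_trans:
  assumes X: "proj_complex X" and Y: "proj_complex Y" and k: "chain_map X Y k"
    and fg: "homotopic X Y f g" and gk: "homotopic X Y g k"
  shows "homotopic X Y f k"
proof -
  interpret Y: right_module "cobj Y i" for i
    by (rule proj_complex_module[OF Y])
  obtain h where h: "htpy X Y h"
    and eq: "\<And>i x. x \<in> carrier (cobj X i) \<Longrightarrow> f i x = g i x \<oplus>\<^bsub>cobj Y i\<^esub> htpy_sum X Y h i x"
    using fg by (auto simp: homotopic_iff)
  obtain h' where h': "htpy X Y h'"
    and eq': "\<And>i x. x \<in> carrier (cobj X i) \<Longrightarrow> g i x = k i x \<oplus>\<^bsub>cobj Y i\<^esub> htpy_sum X Y h' i x"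
    using gk by (auto simp: homotopic_iff)
  let ?h = "\<lambda>i x. h' i x \<oplus>\<^bsub>cobj Y (i - 1)\<^esub> h i x"
  show ?thesis
    unfolding homotopic_iff
  proof (intro exI conjI allI ballI)
    show "htpy X Y ?h"
      using h h' by (simp add: htpy_def rmod_hom_plus proj_complex_module[OF Y])
    fix i x assume x: "x \<in> carrier (cobj X i)"
    have "htpy_sum X Y ?h i x = htpy_sum X Y h' i x \<oplus>\<^bsub>cobj Y i\<^esub> htpy_sum X Y h i x"
      using rmod_hom_add[OF cdiff_hom_pred[OF Y] rmod_hom_closed[OF htpy_hom[OF h'] x]
          rmod_hom_closed[OF htpy_hom[OF h] x]] htpy_sum_closed1[OF X Y h x] htpy_sum_closed1[OF X Y h' x]
      by (simp add: htpy_sum_def Y.a_ac)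
    then show "f i x = k i x \<oplus>\<^bsub>cobj Y i\<^esub> htpy_sum X Y ?h i x"
      using eq[OF x] eq'[OF x] htpy_sum_closed[OF X Y h x] htpy_sum_closed[OF X Y h' x]
        chain_map_closed[OF k x]
      by (simp add: Y.a_assoc)
  qed
qed

lemma homotopic_comp_left:
  assumes X: "proj_complex X" and Y: "proj_complex Y" and Z: "proj_complex Z"
    and g: "chain_map X Y g" and k: "chain_map Y Z k" and fg: "homotopic X Y f g"
  shows "homotopic X Z (comp_map k f) (comp_map k g)"
proof -
  obtain h where h: "htpy X Y h"
    and eq: "\<And>i x. x \<in> carrier (cobj X i) \<Longrightarrow> f i x = g i x \<oplus>\<^bsub>cobj Y i\<^esub> htpy_sum X Y h i x"
    using fg by (auto simp: homotopic_iff)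
  show ?thesis
    unfolding homotopic_iff
  proof (intro exI conjI allI ballI)
    show "htpy X Z (\<lambda>i x. k (i - 1) (h i x))"
      unfolding htpy_def by (intro allI rmod_hom_comp[OF htpy_hom[OF h] chain_map_hom[OF k]])
    fix i x assume x: "x \<in> carrier (cobj X i)"
    have "k i (htpy_sum X Y h i x) = htpy_sum X Z (\<lambda>i x. k (i - 1) (h i x)) i x"
      using chain_map_comm[OF k rmod_hom_closed[OF htpy_hom[OF h] x]]
        chain_map_add[OF k htpy_sum_closed1[OF X Y h x]]
      by (simp add: htpy_sum_def)
    then show "comp_map k f i x = comp_map k g i x \<oplus>\<^bsub>cobj Z i\<^esub> htpy_sum X Z (\<lambda>i x. k (i - 1) (h i x)) i x"
      using eq[OF x] chain_map_add[OF k chain_map_closed[OF g x] htpy_sum_closed[OF X Y h x]]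
      by (simp add: comp_map_def)
  qed
qed

lemma homotopic_comp_right:
  assumes k: "chain_map W X k" and fg: "homotopic X Y f g"
  shows "homotopic W Y (comp_map f k) (comp_map g k)"
proof -
  obtain h where h: "htpy X Y h"
    and eq: "\<And>i x. x \<in> carrier (cobj X i) \<Longrightarrow> f i x = g i x \<oplus>\<^bsub>cobj Y i\<^esub> htpy_sum X Y h i x"
    using fg by (auto simp: homotopic_iff)
  show ?thesis
    unfolding homotopic_iff
  proof (intro exI conjI allI ballI)
    show "htpy W Y (\<lambda>i x. h i (k i x))"
      unfolding htpy_def by (intro allI rmod_hom_comp[OF chain_map_hom[OF k] htpy_hom[OF h]])
    fix i x assume x: "x \<in> carrier (cobj W i)"
    show "comp_map f k i x = comp_map g k i x \<oplus>\<^bsub>cobj Y i\<^esub> htpy_sum W Y (\<lambda>i x. h i (k i x)) i x"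
      using eq[OF chain_map_closed[OF k x]] chain_map_comm[OF k x]
      by (simp add: comp_map_def htpy_sum_def)
  qed
qed

section \<open>Finite length and Fitting's lemma\<close>

lemma (in vector_space) dim_strict_mono:
  assumes E: "finite E" and AB: "A \<subset> B" and B: "B \<subseteq> span E" and A: "subspace A"
  shows "dim A < dim B"
proof -
  obtain C where C: "C \<subseteq> A" "independent C" "A \<subseteq> span C"
    using maximal_independent_subset[of A] by metis
  have "C \<subseteq> B" using C AB by auto
  then obtain D where D: "C \<subseteq> D" "D \<subseteq> B" "independent D" "B \<subseteq> span D"
    using maximal_independent_subset_extend[of C B] C(2) by metis
  have "finite D"
    using independent_span_bound[OF E D(3)] D(2) B by auto
  moreover have "C \<noteq> D"
    using span_minimal[OF C(1) A] D(4) AB by auto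
  ultimately have "card C < card D"
    using D(1) by (intro psubset_card_mono) auto
  then show ?thesis
    using basis_card_eq_dim[OF C(1,3,2)] basis_card_eq_dim[OF D(2,4,3)] by simp
qed

text \<open>A submodule is measured by the dimension of its preimage in the coordinate space \<open>\<Lambda>\<^sup>S\<close> of a
  finite generating set \<open>S\<close>. The preimages are subspaces of a function type, spanned by finitely
  many vectors because \<open>\<Lambda>\<close> has finite dimension, and distinct submodules have distinct preimages
  because \<open>\<Lambda>\<^sup>S\<close> maps onto the module.\<close>

lemma submodule_length_function:
  fixes scale :: "'k::field \<Rightarrow> 'a::ring_1 \<Rightarrow> 'a" and M :: "('a, 'm) rmodule"
  assumes fd: "finite_dim_algebra scale" and M: "right_module M" and fg: "finitely_generated M"
  shows "\<exists>r :: 'm set \<Rightarrow> nat. \<forall>A B. submodule M A \<longrightarrow> submodule M B \<longrightarrow> A \<subset> B \<longrightarrow> r A < r B"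
proof -
  interpret M: right_module M by fact
  obtain Ba where "finite_dimensional_vector_space scale Ba"
    using finite_dim_algebra.finite_dim[OF fd] by auto
  then interpret L: finite_dimensional_vector_space scale Ba .
  obtain S where S: "finite S" "S \<subseteq> carrier M" "\<And>x. x \<in> carrier M \<Longrightarrow> \<exists>c. x = lincomb M S c"
    using fg by (auto simp: finitely_generated_iff)
  let ?sc = "\<lambda>k (c :: 'm \<Rightarrow> 'a) s. scale k (c s)"
  interpret V: vector_space ?sc
    by unfold_locales (simp_all add: fun_eq_iff L.scale_right_distrib L.scale_left_distrib)
  let ?pre = "\<lambda>A. {c. (\<forall>s. s \<notin> S \<longrightarrow> c s = 0) \<and> lincomb M S c \<in> A}"
  let ?u = "\<lambda>t b s. if s = t then b else (0 :: 'a)"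
  let ?E = "(\<lambda>(t, b). ?u t b) ` (S \<times> Ba)"
  have unit: "?u t x \<in> V.span ?E" if t: "t \<in> S" for t x
  proof -
    have "x \<in> L.span Ba"
      using L.span_Basis by simp
    then show ?thesis
    proof (induction rule: L.span_induct_alt)
      case base
      have "?u t 0 = 0" by (simp add: fun_eq_iff)
      then show ?case using V.span_zero[of ?E] by simp
    next
      case (step k b y)
      have bE: "?u t b \<in> ?E" using step(1) t by force
      have "?sc k (?u t b) + ?u t y \<in> V.span ?E"
        by (rule V.span_add[OF V.span_scale[OF V.span_base[OF bE]] step(2)])
      moreover have "?sc k (?u t b) + ?u t y = ?u t (scale k b + y)"
        by (simp add: fun_eq_iff)
      ultimately show ?case by simp
    qed
  qed
  have fin: "?pre A \<subseteq> V.span ?E" for A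
  proof
    fix c assume c: "c \<in> ?pre A"
    have "(\<Sum>t\<in>S. ?u t (c t)) \<in> V.span ?E"
      using unit by (intro V.span_sum) auto
    moreover have "(\<Sum>t\<in>S. ?u t (c t)) = c"
    proof
      fix s
      have "(\<Sum>t\<in>S. ?u t (c t)) s = (\<Sum>t\<in>S. if s = t then c t else 0)"
        by (induction S rule: infinite_finite_induct) auto
      also have "\<dots> = c s"
        using c S(1) by (auto simp: sum.delta')
      finally show "(\<Sum>t\<in>S. ?u t (c t)) s = c s" .
    qed
    ultimately show "c \<in> V.span ?E" by simp
  qed
  have sub: "V.subspace (?pre A)" if A: "submodule M A" for A
  proof (rule V.subspaceI)
    show "0 \<in> ?pre A"
      using submodule_zero[OF A] M.lincomb_zero[OF S(1,2)] by (simp add: zero_fun_def)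
    show "c + c' \<in> ?pre A" if "c \<in> ?pre A" "c' \<in> ?pre A" for c c'
      using that submodule_add[OF A] M.lincomb_add[OF S(2), of c c'] by (simp add: plus_fun_def)
    show "?sc k c \<in> ?pre A" if "c \<in> ?pre A" for k c
    proof -
      have "?sc k c = (\<lambda>s. c s * scale k 1)"
        by (simp add: finite_dim_algebra.scale_mult_right[OF fd])
      then show ?thesis
        using that submodule_act[OF A] M.lincomb_mult[OF S(1,2), of c "scale k 1"] by auto
    qed
  qed
  have "V.dim (?pre A) < V.dim (?pre B)"
    if A: "submodule M A" and B: "submodule M B" and AB: "A \<subset> B" for A B
  proof (rule V.dim_strict_mono[OF _ _ fin sub[OF A]])
    show "finite ?E"
      using S(1) L.finite_Basis by simp
    obtain x where x: "x \<in> B" "x \<notin> A"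
      using AB by auto
    then obtain c where c: "x = lincomb M S c"
      using S(3) submodule_carrierD[OF B] by blast
    have "lincomb M S (\<lambda>s. if s \<in> S then c s else 0) = x"
      unfolding c by (rule M.lincomb_cong[OF S(2)]) simp
    then have "(\<lambda>s. if s \<in> S then c s else 0) \<in> ?pre B - ?pre A"
      using x by simp
    then show "?pre A \<subset> ?pre B"
      using AB by blast
  qed
  then show ?thesis
    by (intro exI[of _ "\<lambda>A. V.dim (?pre A)"]) simp
qed

text \<open>A family of submodules, one in each degree, without a condition on the differential. Such
  families already satisfy both chain conditions, which is what makes images and kernels of powers
  stabilise and inductions on summands terminate.\<close>

definition graded_submodule :: "'a::ring_1 cplx \<Rightarrow> (int \<Rightarrow> (nat \<Rightarrow> 'a) set) \<Rightarrow> bool" where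
  "graded_submodule X A \<longleftrightarrow> (\<forall>i. submodule (cobj X i) (A i))"

text \<open>Outside the finitely many degrees where the complex lives all graded submodules agree, so the
  length functions of the terms can be added up.\<close>

lemma graded_submodule_length_function:
  fixes scale :: "'k::field \<Rightarrow> 'a::ring_1 \<Rightarrow> 'a" and X :: "'a cplx"
  assumes fd: "finite_dim_algebra scale" and X: "Cb X"
  shows "\<exists>r :: (int \<Rightarrow> (nat \<Rightarrow> 'a) set) \<Rightarrow> nat.
    \<forall>A B. graded_submodule X A \<longrightarrow> graded_submodule X B \<longrightarrow> A < B \<longrightarrow> r A < r B"
proof -
  obtain a b where ab: "\<And>i. i < a \<or> b < i \<Longrightarrow> zero_module (cobj X i)"
    using X by (auto simp: Cb_def)
  have pX: "proj_complex X"
    using X by (simp add: Cb_def)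
  have "\<exists>r :: (nat \<Rightarrow> 'a) set \<Rightarrow> nat. \<forall>A B. submodule (cobj X i) A \<longrightarrow> submodule (cobj X i) B
      \<longrightarrow> A \<subset> B \<longrightarrow> r A < r B" for i
    using pX by (intro submodule_length_function[OF fd proj_complex_module[OF pX]])
      (simp add: proj_complex_def proj_module_def)
  then obtain r :: "int \<Rightarrow> (nat \<Rightarrow> 'a) set \<Rightarrow> nat"
    where r: "\<And>i A B. submodule (cobj X i) A \<Longrightarrow> submodule (cobj X i) B \<Longrightarrow> A \<subset> B \<Longrightarrow> r i A < r i B"
    by metis
  have "(\<Sum>i=a..b. r i (A i)) < (\<Sum>i=a..b. r i (B i))"
    if A: "graded_submodule X A" and B: "graded_submodule X B" and AB: "A < B" for A B
  proof (rule sum_strict_mono_ex1)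
    have le: "A i \<subseteq> B i" for i
      using AB by (simp add: less_fun_def le_fun_def)
    have rA: "r i (A i) < r i (B i)" if "A i \<noteq> B i" for i
      using r[of i "A i" "B i"] A B le[of i] that by (auto simp: graded_submodule_def)
    show "\<forall>i\<in>{a..b}. r i (A i) \<le> r i (B i)"
      using rA by (metis less_imp_le order_refl)
    obtain i where i: "\<not> B i \<subseteq> A i"
      using AB by (auto simp: less_fun_def le_fun_def)
    have "i \<in> {a..b}"
    proof (rule ccontr)
      assume "i \<notin> {a..b}"
      then have "carrier (cobj X i) = {\<zero>\<^bsub>cobj X i\<^esub>}"
        using ab[of i] by (auto simp: zero_module_def)
      moreover have "submodule (cobj X i) (A i)" "submodule (cobj X i) (B i)"
        using A B by (simp_all add: graded_submodule_def)
      ultimately show False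
        using i by (auto simp: submodule_def)
    qed
    then show "\<exists>i\<in>{a..b}. r i (A i) < r i (B i)"
      using rA[of i] i by blast
  qed simp
  then show ?thesis
    by (intro exI[of _ "\<lambda>A. \<Sum>i=a..b. r i (A i)"]) simp
qed

lemma graded_submodule_image:
  assumes "proj_complex X" "proj_complex Y" "chain_map X Y f" "graded_submodule X A"
  shows "graded_submodule Y (\<lambda>i. f i ` A i)"
  using assms by (simp add: graded_submodule_def
      submodule_image[OF proj_complex_module proj_complex_module chain_map_hom])

lemma graded_submodule_carrier: "proj_complex X \<Longrightarrow> graded_submodule X (\<lambda>i. carrier (cobj X i))"
  by (simp add: graded_submodule_def submodule_carrier proj_complex_module)

lemma graded_submodule_le_carrier: "graded_submodule X A \<Longrightarrow> A \<le> (\<lambda>i. carrier (cobj X i))"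
  by (auto simp: graded_submodule_def submodule_def le_fun_def)

definition kernel :: "'a::ring_1 cplx \<Rightarrow> 'a cmap \<Rightarrow> int \<Rightarrow> (nat \<Rightarrow> 'a) set" where
  "kernel X f i = {x \<in> carrier (cobj X i). f i x = \<zero>\<^bsub>cobj X i\<^esub>}"

lemma graded_submodule_kernel:
  assumes X: "proj_complex X" and f: "chain_map X X f"
  shows "graded_submodule X (kernel X f)"
proof -
  interpret right_module "cobj X i" for i
    by (rule proj_complex_module[OF X])
  show ?thesis
    unfolding graded_submodule_def submodule_def kernel_def
    using chain_map_zero[OF X X f] chain_map_add[OF f] rmod_hom_act[OF chain_map_hom[OF f]]
    by (simp add: act_closed)
qed

lemma graded_submodule_descending_stable:
  fixes scale :: "'k::field \<Rightarrow> 'a::ring_1 \<Rightarrow> 'a"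
  assumes fd: "finite_dim_algebra scale" and X: "Cb (X :: 'a cplx)"
    and A: "\<And>n. graded_submodule X (A n)" and dec: "\<And>n. A (Suc n) \<le> A n"
  shows "\<exists>N. \<forall>n\<ge>N. A n = A N"
proof -
  obtain r :: "(int \<Rightarrow> (nat \<Rightarrow> 'a) set) \<Rightarrow> nat"
    where r: "\<And>A B. graded_submodule X A \<Longrightarrow> graded_submodule X B \<Longrightarrow> A < B \<Longrightarrow> r A < r B"
    using graded_submodule_length_function[OF fd X] by metis
  obtain N where N: "\<And>n. r (A N) \<le> r (A n)"
    using ex_has_least_nat[of "\<lambda>_. True" _ "\<lambda>n. r (A n)"] by auto
  have "A n = A N" if "n \<ge> N" for n
  proof (rule ccontr)
    assume "A n \<noteq> A N"
    then have "A n < A N"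
      using lift_Suc_antimono_le[of A, OF dec that] by simp
    then show False
      using r[OF A A] N[of n] by (meson leD)
  qed
  then show ?thesis by blast
qed

lemma graded_submodule_ascending_stable:
  fixes scale :: "'k::field \<Rightarrow> 'a::ring_1 \<Rightarrow> 'a"
  assumes fd: "finite_dim_algebra scale" and X: "Cb (X :: 'a cplx)"
    and A: "\<And>n. graded_submodule X (A n)" and inc: "\<And>n. A n \<le> A (Suc n)"
  shows "\<exists>N. \<forall>n\<ge>N. A n = A N"
proof -
  obtain r :: "(int \<Rightarrow> (nat \<Rightarrow> 'a) set) \<Rightarrow> nat"
    where r: "\<And>A B. graded_submodule X A \<Longrightarrow> graded_submodule X B \<Longrightarrow> A < B \<Longrightarrow> r A < r B"
    using graded_submodule_length_function[OF fd X] by metis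
  let ?T = "\<lambda>i. carrier (cobj X i)"
  have "graded_submodule X ?T"
    using X by (intro graded_submodule_carrier) (simp add: Cb_def)
  then have "r (A n) < Suc (r ?T)" for n
    using r[OF A, of ?T n] graded_submodule_le_carrier[OF A, of n] by (metis le_less less_SucI lessI)
  then obtain N where N: "\<And>n. r (A n) \<le> r (A N)"
    using ex_has_greatest_nat[of "\<lambda>_. True" 0 "\<lambda>n. r (A n)" "Suc (r ?T)"] by auto
  have "A n = A N" if "n \<ge> N" for n
  proof (rule ccontr)
    assume "A n \<noteq> A N"
    then have "A N < A n"
      using lift_Suc_mono_le[of A, OF inc that] by simp
    then show False
      using r[OF A A] N[of n] by (meson leD)
  qed
  then show ?thesis by blast
qed

subsection \<open>Fitting's lemma\<close>

lemma chain_map_pow: "chain_map X X e \<Longrightarrow> chain_map X X (\<lambda>i. e i ^^ n)"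
proof (induction n)
  case 0
  then show ?case using chain_map_id[of X] by (simp add: id_map_def id_def)
next
  case (Suc n)
  then show ?case
    using chain_map_comp[of X X "\<lambda>i. e i ^^ n" X e] by (simp add: comp_map_def comp_def)
qed

lemma bij_chain_map_inverse:
  assumes X: "proj_complex X" and f: "chain_map X X f"
    and bij: "\<And>i. bij_betw (f i) (carrier (cobj X i)) (carrier (cobj X i))"
  shows "\<exists>g. chain_map X X g \<and> (\<forall>i. \<forall>x\<in>carrier (cobj X i). g i (f i x) = x)"
proof -
  interpret right_module "cobj X i" for i
    by (rule proj_complex_module[OF X])
  let ?g = "\<lambda>i. inv_into (carrier (cobj X i)) (f i)"
  have gf: "?g i (f i x) = x" if "x \<in> carrier (cobj X i)" for i x
    by (rule bij_betw_inv_into_left[OF bij that])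
  have fg: "f i (?g i x) = x" if "x \<in> carrier (cobj X i)" for i x
    by (rule bij_betw_inv_into_right[OF bij that])
  have gcl: "?g i x \<in> carrier (cobj X i)" if "x \<in> carrier (cobj X i)" for i x
    using bij_betwE[OF bij_betw_inv_into[OF bij[of i]]] that by simp
  \<comment> \<open>By injectivity of \<open>f\<close> each identity for the inverse only has to be checked after applying \<open>f\<close>.\<close>
  have inj: "?g i z = y" if "y \<in> carrier (cobj X i)" "f i y = z" for i y z
    using gf that by auto
  have "chain_map X X ?g"
  proof (rule chain_mapI)
    show "?g i \<in> rmod_hom (cobj X i) (cobj X i)" for i
      by (intro rmod_homI inj)
        (simp_all add: gcl fg chain_map_add[OF f] rmod_hom_act[OF chain_map_hom[OF f]] act_closed)
    show "cdiff X i (?g i x) = ?g (i + 1) (cdiff X i x)" if "x \<in> carrier (cobj X i)" for i x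
      using that
      by (intro inj[symmetric])
        (simp_all add: gcl fg cdiff_closed[OF X] chain_map_comm[OF f, symmetric])
  qed
  then show ?thesis
    using gf by blast
qed

text \<open>If \<open>f\<close> and \<open>f \<circ> f\<close> have the same image and the same kernel, the complex is the direct sum of
  this image and this kernel. The projection onto the image sends \<open>x\<close> to the unique \<open>y\<close> in the image with
  \<open>f y = f x\<close>, and uniqueness makes it a chain map.\<close>

lemma stable_image_projection:
  assumes X: "proj_complex X" and f: "chain_map X X f"
    and ker: "\<And>i x. x \<in> carrier (cobj X i) \<Longrightarrow> f i (f i x) = \<zero>\<^bsub>cobj X i\<^esub> \<Longrightarrow> f i x = \<zero>\<^bsub>cobj X i\<^esub>"
    and im: "\<And>i x. x \<in> carrier (cobj X i) \<Longrightarrow> \<exists>y\<in>carrier (cobj X i). f i x = f i (f i y)"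
  shows "\<exists>\<pi>. idempotent X \<pi> \<and> (\<forall>i. \<forall>x\<in>carrier (cobj X i).
    \<pi> i x \<in> f i ` carrier (cobj X i) \<and> f i (\<pi> i x) = f i x)"
proof -
  interpret right_module "cobj X i" for i
    by (rule proj_complex_module[OF X])
  note fcl = chain_map_closed[OF f]
  have sub: "submodule (cobj X i) (f i ` carrier (cobj X i))" for i
    using graded_submodule_image[OF X X f graded_submodule_carrier[OF X]] by (simp add: graded_submodule_def)
  define \<pi> where "\<pi> i x = (SOME y. y \<in> f i ` carrier (cobj X i) \<and> f i y = f i x)" for i x
  have \<pi>: "\<pi> i x \<in> f i ` carrier (cobj X i) \<and> f i (\<pi> i x) = f i x"
    if "x \<in> carrier (cobj X i)" for i x
    unfolding \<pi>_def
  proof (rule someI_ex[of "\<lambda>y. y \<in> f i ` carrier (cobj X i) \<and> f i y = f i x"])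
    show "\<exists>y. y \<in> f i ` carrier (cobj X i) \<and> f i y = f i x"
      using im[OF that] by (metis imageI)
  qed
  have unique: "\<pi> i x = y"
    if x: "x \<in> carrier (cobj X i)" and y: "y \<in> f i ` carrier (cobj X i)" and eq: "f i y = f i x"
    for i x y
  proof -
    obtain a where a: "a \<in> carrier (cobj X i)" "\<pi> i x = f i a"
      using \<pi>[OF x] by auto
    obtain b where b: "b \<in> carrier (cobj X i)" "y = f i b"
      using y by auto
    have diff: "f i (a \<ominus>\<^bsub>cobj X i\<^esub> b) = f i a \<ominus>\<^bsub>cobj X i\<^esub> f i b"
      by (rule chain_map_minus[OF X X f a(1) b(1)])
    have "f i (f i a) = f i (f i b)"
      using \<pi>[OF x] a(2) b(2) eq by simp
    then have "f i (f i a \<ominus>\<^bsub>cobj X i\<^esub> f i b) = \<zero>\<^bsub>cobj X i\<^esub>"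
      using chain_map_minus[OF X X f fcl[OF a(1)] fcl[OF b(1)]] fcl[OF fcl[OF b(1)]]
      by (simp add: a_minus_def r_neg)
    then have "f i a \<ominus>\<^bsub>cobj X i\<^esub> f i b = \<zero>\<^bsub>cobj X i\<^esub>"
      using ker[of "a \<ominus>\<^bsub>cobj X i\<^esub> b" i] diff a(1) b(1) by simp
    then show ?thesis
      using a b minus_eq_zeroD[OF _ fcl[OF a(1)] fcl[OF b(1)]] by simp
  qed
  have cl: "\<pi> i x \<in> carrier (cobj X i)" if "x \<in> carrier (cobj X i)" for i x
    using \<pi>[OF that] fcl by auto
  have "chain_map X X \<pi>"
  proof (rule chain_mapI)
    fix i
    show "\<pi> i \<in> rmod_hom (cobj X i) (cobj X i)"
    proof (rule rmod_homI)
      fix x y r assume x: "x \<in> carrier (cobj X i)"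
      show "\<pi> i x \<in> carrier (cobj X i)"
        by (rule cl[OF x])
      show "\<pi> i (x \<triangleleft>\<^bsub>cobj X i\<^esub> r) = \<pi> i x \<triangleleft>\<^bsub>cobj X i\<^esub> r"
        using \<pi>[OF x] x submodule_act[OF sub, of "\<pi> i x" i r]
        by (intro unique) (simp_all add: act_closed cl rmod_hom_act[OF chain_map_hom[OF f]])
      assume y: "y \<in> carrier (cobj X i)"
      show "\<pi> i (x \<oplus>\<^bsub>cobj X i\<^esub> y) = \<pi> i x \<oplus>\<^bsub>cobj X i\<^esub> \<pi> i y"
        using \<pi>[OF x] \<pi>[OF y] x y submodule_add[OF sub, of "\<pi> i x" i "\<pi> i y"]
        by (intro unique) (simp_all add: cl chain_map_add[OF f])
    qed
  next
    fix i x assume x: "x \<in> carrier (cobj X i)"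
    obtain a where a: "a \<in> carrier (cobj X i)" "\<pi> i x = f i a"
      using \<pi>[OF x] by auto
    have "cdiff X i (\<pi> i x) \<in> f (i + 1) ` carrier (cobj X (i + 1))"
      unfolding a(2) chain_map_comm[OF f a(1)] by (rule imageI[OF cdiff_closed[OF X a(1)]])
    then show "cdiff X i (\<pi> i x) = \<pi> (i + 1) (cdiff X i x)"
      using \<pi>[OF x] x
      by (intro unique[symmetric])
        (simp_all add: cdiff_closed[OF X] cl chain_map_comm[OF f, symmetric])
  qed
  moreover have "\<pi> i (\<pi> i x) = \<pi> i x" if "x \<in> carrier (cobj X i)" for i x
    using \<pi>[OF that] that by (intro unique) (simp_all add: cl)
  ultimately show ?thesis
    using \<pi> by (auto simp: idempotent_def)
qed

text \<open>For large \<open>N\<close> the images and the kernels of the powers of \<open>e\<close> are stable, so the image of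
  \<open>e\<^sup>N\<close> is a direct summand and thus zero or everything.\<close>

lemma indecomposable_fitting:
  fixes scale :: "'k::field \<Rightarrow> 'a::ring_1 \<Rightarrow> 'a"
  assumes fd: "finite_dim_algebra scale" and CX: "Cb (X :: 'a cplx)" and ind: "indecomposable_C X"
    and e: "chain_map X X e"
  shows "\<exists>N>0. (\<forall>i. \<forall>x\<in>carrier (cobj X i). (e i ^^ N) x = \<zero>\<^bsub>cobj X i\<^esub>)
    \<or> (\<exists>g. chain_map X X g \<and> (\<forall>i. \<forall>x\<in>carrier (cobj X i). g i ((e i ^^ N) x) = x))"
proof -
  have X: "proj_complex X"
    using CX by (simp add: Cb_def)
  note pow = chain_map_pow[OF e]
  note powcl = chain_map_closed[OF pow]
  let ?I = "\<lambda>n i. (e i ^^ n) ` carrier (cobj X i)"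
  let ?K = "\<lambda>n. kernel X (\<lambda>i. e i ^^ n)"
  have subI: "graded_submodule X (?I n)" and subK: "graded_submodule X (?K n)" for n
    using graded_submodule_image[OF X X pow graded_submodule_carrier[OF X], of n] graded_submodule_kernel[OF X pow, of n] by auto
  have I: "?I (Suc n) \<le> ?I n" for n
    using chain_map_closed[OF e] by (auto simp: le_fun_def funpow_swap1)
  have K: "?K n \<le> ?K (Suc n)" for n
    using chain_map_zero[OF X X e] by (auto simp: le_fun_def kernel_def)
  have "\<exists>N. \<forall>n\<ge>N. ?I n = ?I N"
    by (rule graded_submodule_descending_stable[OF fd CX, of ?I, OF subI I])
  then obtain N1 where N1: "\<forall>n\<ge>N1. ?I n = ?I N1" ..
  have "\<exists>N. \<forall>n\<ge>N. ?K n = ?K N"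
    by (rule graded_submodule_ascending_stable[OF fd CX, of ?K, OF subK K])
  then obtain N2 where N2: "\<forall>n\<ge>N2. ?K n = ?K N2" ..
  \<comment> \<open>The exponent is made positive because an endomorphism that is idempotent up to homotopy is
    homotopic to its positive powers, but in general not to the identity.\<close>
  define N where "N = Suc (max N1 N2)"
  define f where "f = (\<lambda>i. e i ^^ N)"
  have ff: "f i (f i x) = (e i ^^ (N + N)) x" for i x
    by (simp add: f_def funpow_add)
  have f: "chain_map X X f"
    unfolding f_def by (rule pow)
  have "?I (N + N) = ?I N"
    using N1[rule_format, of N] N1[rule_format, of "N + N"] by (simp add: N_def)
  then have I2: "f i ` carrier (cobj X i) = (e i ^^ (N + N)) ` carrier (cobj X i)" for i
    unfolding f_def fun_eq_iff by simp
  have im: "\<exists>y\<in>carrier (cobj X i). f i x = f i (f i y)" if "x \<in> carrier (cobj X i)" for i x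
    using imageI[OF that, of "f i"] unfolding I2 ff[symmetric] by (auto elim!: imageE)
  have "?K (N + N) = ?K N"
    using N2[rule_format, of N] N2[rule_format, of "N + N"] by (simp add: N_def)
  then have "kernel X (\<lambda>i. e i ^^ (N + N)) i = kernel X f i" for i
    by (simp add: f_def)
  then have ker: "f i x = \<zero>\<^bsub>cobj X i\<^esub>"
    if "x \<in> carrier (cobj X i)" "f i (f i x) = \<zero>\<^bsub>cobj X i\<^esub>" for i x
    using that unfolding ff by (auto simp: kernel_def)
  obtain \<pi> where \<pi>: "idempotent X \<pi>"
    "\<And>i x. x \<in> carrier (cobj X i) \<Longrightarrow> \<pi> i x \<in> f i ` carrier (cobj X i)"
    "\<And>i x. x \<in> carrier (cobj X i) \<Longrightarrow> f i (\<pi> i x) = f i x"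
    using stable_image_projection[OF X f ker im] by metis
  have "(\<forall>i. \<forall>x\<in>carrier (cobj X i). f i x = \<zero>\<^bsub>cobj X i\<^esub>)
    \<or> (\<exists>g. chain_map X X g \<and> (\<forall>i. \<forall>x\<in>carrier (cobj X i). g i (f i x) = x))"
    using indecomposable_idempotent_trivial[OF ind \<pi>(1)]
  proof
    assume z: "\<forall>i. \<forall>x\<in>carrier (cobj X i). \<pi> i x = \<zero>\<^bsub>cobj X i\<^esub>"
    have "f i x = \<zero>\<^bsub>cobj X i\<^esub>" if "x \<in> carrier (cobj X i)" for i x
      using \<pi>(3)[OF that] z that chain_map_zero[OF X X f] by simp
    then show ?thesis by blast
  next
    assume one: "\<forall>i. \<forall>x\<in>carrier (cobj X i). \<pi> i x = x"
    interpret right_module "cobj X i" for i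
      by (rule proj_complex_module[OF X])
    have surj: "x \<in> f i ` carrier (cobj X i)" if "x \<in> carrier (cobj X i)" for i x
      using \<pi>(2)[OF that] one that by simp
    have k0: "x = \<zero>\<^bsub>cobj X i\<^esub>" if x: "x \<in> carrier (cobj X i)" "f i x = \<zero>\<^bsub>cobj X i\<^esub>" for i x
      using surj[OF x(1)] x(2) ker by auto
    have "bij_betw (f i) (carrier (cobj X i)) (carrier (cobj X i))" for i
      unfolding bij_betw_def
    proof (intro conjI inj_onI)
      fix x y assume x: "x \<in> carrier (cobj X i)" and y: "y \<in> carrier (cobj X i)" and eq: "f i x = f i y"
      have "x \<ominus>\<^bsub>cobj X i\<^esub> y = \<zero>\<^bsub>cobj X i\<^esub>"
        using x y eq chain_map_minus[OF X X f x y] chain_map_closed[OF f y]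
        by - (rule k0, simp_all add: a_minus_def r_neg)
      then show "x = y"
        using x y by (rule minus_eq_zeroD)
    qed (use surj chain_map_closed[OF f] in auto)
    from bij_chain_map_inverse[OF X f this] show ?thesis by blast
  qed
  then show ?thesis
    by (intro exI[of _ N]) (simp add: f_def N_def)
qed

section \<open>Direct sums in the category of complexes\<close>

definition biproduct ::
  "'a::ring_1 cplx \<Rightarrow> 'a cplx \<Rightarrow> 'a cplx \<Rightarrow> 'a cmap \<Rightarrow> 'a cmap \<Rightarrow> 'a cmap \<Rightarrow> 'a cmap \<Rightarrow> bool" where
  "biproduct X Y Z iY iZ pY pZ \<longleftrightarrow>
     chain_map Y X iY \<and> chain_map Z X iZ \<and> chain_map X Y pY \<and> chain_map X Z pZ \<and>
     (\<forall>i. \<forall>y\<in>carrier (cobj Y i). pY i (iY i y) = y) \<and>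
     (\<forall>i. \<forall>z\<in>carrier (cobj Z i). pZ i (iZ i z) = z) \<and>
     (\<forall>i. \<forall>z\<in>carrier (cobj Z i). pY i (iZ i z) = \<zero>\<^bsub>cobj Y i\<^esub>) \<and>
     (\<forall>i. \<forall>y\<in>carrier (cobj Y i). pZ i (iY i y) = \<zero>\<^bsub>cobj Z i\<^esub>) \<and>
     (\<forall>i. \<forall>x\<in>carrier (cobj X i). iY i (pY i x) \<oplus>\<^bsub>cobj X i\<^esub> iZ i (pZ i x) = x)"

lemma direct_sum_map_eq_iff:
  "direct_sum map_eq X Y Z \<longleftrightarrow> (\<exists>iY iZ pY pZ. biproduct X Y Z iY iZ pY pZ)"
  by (simp add: direct_sum_def biproduct_def map_eq_def comp_map_def id_map_def zero_map_def add_map_def)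

lemma biproductD:
  assumes "biproduct X Y Z iY iZ pY pZ"
  shows "chain_map Y X iY" "chain_map Z X iZ" "chain_map X Y pY" "chain_map X Z pZ"
    and "\<And>i y. y \<in> carrier (cobj Y i) \<Longrightarrow> pY i (iY i y) = y"
    and "\<And>i z. z \<in> carrier (cobj Z i) \<Longrightarrow> pZ i (iZ i z) = z"
    and "\<And>i z. z \<in> carrier (cobj Z i) \<Longrightarrow> pY i (iZ i z) = \<zero>\<^bsub>cobj Y i\<^esub>"
    and "\<And>i y. y \<in> carrier (cobj Y i) \<Longrightarrow> pZ i (iY i y) = \<zero>\<^bsub>cobj Z i\<^esub>"
    and "\<And>i x. x \<in> carrier (cobj X i) \<Longrightarrow> iY i (pY i x) \<oplus>\<^bsub>cobj X i\<^esub> iZ i (pZ i x) = x"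
  using assms by (simp_all add: biproduct_def)

lemma biproduct_commute:
  assumes X: "proj_complex X" and b: "biproduct X Y Z iY iZ pY pZ"
  shows "biproduct X Z Y iZ iY pZ pY"
proof -
  interpret right_module "cobj X i" for i
    by (rule proj_complex_module[OF X])
  have "iZ i (pZ i x) \<oplus>\<^bsub>cobj X i\<^esub> iY i (pY i x) = x" if x: "x \<in> carrier (cobj X i)" for i x
    using biproductD(9)[OF b x] chain_map_closed[OF biproductD(1)[OF b] chain_map_closed[OF biproductD(3)[OF b] x]]
      chain_map_closed[OF biproductD(2)[OF b] chain_map_closed[OF biproductD(4)[OF b] x]] by (simp add: a_comm)
  then show ?thesis
    using biproductD[OF b] by (simp add: biproduct_def)
qed

lemma direct_sum_commute: "proj_complex X \<Longrightarrow> direct_sum map_eq X Y Z \<Longrightarrow> direct_sum map_eq X Z Y"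
  unfolding direct_sum_map_eq_iff using biproduct_commute by metis

lemma zero_module_summand:
  assumes X: "proj_complex X" and Y: "proj_complex Y" and s: "direct_sum map_eq X Y Z"
    and z: "zero_module (cobj X i)"
  shows "zero_module (cobj Y i)"
proof -
  obtain iY iZ pY pZ where b: "biproduct X Y Z iY iZ pY pZ"
    using s by (auto simp: direct_sum_map_eq_iff)
  note c = biproductD(1,3)[OF b] and pi = biproductD(5)[OF b]
  have zero: "y = \<zero>\<^bsub>cobj Y i\<^esub>" if y: "y \<in> carrier (cobj Y i)" for y
    using pi[OF y] chain_map_closed[OF c(1) y] z chain_map_zero[OF X Y c(2), of i]
    by (simp add: zero_module_def)
  show ?thesis
    unfolding zero_module_def
  proof (intro equalityI subsetI)
    show "y \<in> {\<zero>\<^bsub>cobj Y i\<^esub>}" if "y \<in> carrier (cobj Y i)" for y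
      using zero[OF that] by simp
    show "y \<in> carrier (cobj Y i)" if "y \<in> {\<zero>\<^bsub>cobj Y i\<^esub>}" for y
      using that cobj_zero_closed[OF Y, of i] by simp
  qed
qed

lemma zero_module_summands:
  assumes "proj_complex X" "proj_complex Y" "proj_complex Z" "direct_sum map_eq X Y Z"
    and "zero_module (cobj X i)"
  shows "zero_module (cobj Y i)" "zero_module (cobj Z i)"
  using zero_module_summand[OF assms(1,2,4,5)]
    zero_module_summand[OF assms(1,3) direct_sum_commute[OF assms(1,4)] assms(5)] by auto

lemma Cn_imp_Cb: "Cn n X \<Longrightarrow> Cb X"
  unfolding Cn_def Cb_def by (intro conjI exI[of _ 1] exI[of _ "int n"]) auto

lemma not_zero_module:
  assumes "proj_complex X" "\<not> zero_module (cobj X i)"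
  obtains x where "x \<in> carrier (cobj X i)" "x \<noteq> \<zero>\<^bsub>cobj X i\<^esub>"
  using assms cobj_zero_closed[of X i] by (auto simp: zero_module_def)

subsection \<open>Composition length\<close>

text \<open>The length of the underlying graded module. The greatest length of a chain does not depend on a choice of generators,
  unlike the length functions constructed above. Hence it can be compared between a complex and its
  summands.\<close>

definition has_submodule_chain :: "'a::ring_1 cplx \<Rightarrow> nat \<Rightarrow> bool" where
  "has_submodule_chain X n \<longleftrightarrow> (\<exists>A. (\<forall>j. graded_submodule X (A j)) \<and> (\<forall>j<n. A j < A (Suc j)))"

definition composition_length :: "'a::ring_1 cplx \<Rightarrow> nat" where
  "composition_length X = Max {n. has_submodule_chain X n}"

lemma composition_length:
  fixes scale :: "'k::field \<Rightarrow> 'a::ring_1 \<Rightarrow> 'a"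
  assumes fd: "finite_dim_algebra scale" and CX: "Cb (X :: 'a cplx)"
  shows "has_submodule_chain X (composition_length X)"
    and "has_submodule_chain X n \<Longrightarrow> n \<le> composition_length X"
proof -
  have X: "proj_complex X"
    using CX by (simp add: Cb_def)
  obtain r :: "(int \<Rightarrow> (nat \<Rightarrow> 'a) set) \<Rightarrow> nat"
    where r: "\<And>A B. graded_submodule X A \<Longrightarrow> graded_submodule X B \<Longrightarrow> A < B \<Longrightarrow> r A < r B"
    using graded_submodule_length_function[OF fd CX] by metis
  let ?T = "\<lambda>i. carrier (cobj X i)"
  have bound: "n \<le> r ?T" if "has_submodule_chain X n" for n
  proof -
    obtain A where A: "\<And>j. graded_submodule X (A j)" "\<And>j. j < n \<Longrightarrow> A j < A (Suc j)"
      using \<open>has_submodule_chain X n\<close> by (auto simp: has_submodule_chain_def)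
    have "j \<le> r (A j)" if "j \<le> n" for j
      using that
    proof (induction j)
      case (Suc j)
      then show ?case using r[OF A(1) A(1) A(2), of j] by simp
    qed simp
    then have "n \<le> r (A n)" by simp
    also have "r (A n) \<le> r ?T"
      using r[OF A(1) graded_submodule_carrier[OF X], of n] graded_submodule_le_carrier[OF A(1), of n]
      by (metis le_less order_refl)
    finally show ?thesis .
  qed
  then have "finite {n. has_submodule_chain X n}"
    by (auto intro: finite_subset[of _ "{..r ?T}"])
  moreover have "has_submodule_chain X 0"
    using graded_submodule_carrier[OF X] by (auto simp: has_submodule_chain_def)
  ultimately show "has_submodule_chain X (composition_length X)"
    "has_submodule_chain X n \<Longrightarrow> n \<le> composition_length X"
    using Max_in[of "{n. has_submodule_chain X n}"] by (auto simp: composition_length_def)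
qed

text \<open>A chain of graded submodules of the summand stays strict in the sum and can be prolonged by the
  whole sum.\<close>

lemma composition_length_summand:
  fixes scale :: "'k::field \<Rightarrow> 'a::ring_1 \<Rightarrow> 'a"
  assumes fd: "finite_dim_algebra scale" and CX: "Cb (X :: 'a cplx)" and CY: "Cb Y"
    and Z: "proj_complex Z" and s: "direct_sum map_eq X Y Z" and nz: "\<not> zero_obj map_eq Z"
  shows "composition_length Y < composition_length X"
proof -
  have X: "proj_complex X" and Y: "proj_complex Y"
    using CX CY by (simp_all add: Cb_def)
  obtain iY iZ pY pZ where b: "biproduct X Y Z iY iZ pY pZ"
    using s by (auto simp: direct_sum_map_eq_iff)
  note c = biproductD(1-4)[OF b]
  note pyi = biproductD(5)[OF b] and pzi = biproductD(6)[OF b] and pzy = biproductD(8)[OF b]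
  let ?n = "composition_length Y" and ?T = "\<lambda>i. carrier (cobj X i)"
  obtain A where A: "\<And>j. graded_submodule Y (A j)" "\<And>j. j < ?n \<Longrightarrow> A j < A (Suc j)"
    using composition_length(1)[OF fd CY] by (auto simp: has_submodule_chain_def)
  have subA: "A j i \<subseteq> carrier (cobj Y i)" for j i
    using A(1) by (auto simp: graded_submodule_def submodule_def)
  define B where "B j = (if j \<le> ?n then \<lambda>i. iY i ` A j i else ?T)" for j
  have subB: "graded_submodule X (B j)" for j
    using graded_submodule_image[OF Y X c(1) A(1)] graded_submodule_carrier[OF X] by (simp add: B_def)
  have "B j < B (Suc j)" if "j < Suc ?n" for j
  proof (cases "j = ?n")
    case False
    have Aj: "A j < A (Suc j)"
      using that False by (intro A(2)) simp
    have retract: "pY i ` iY i ` A k i = A k i" for k i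
    proof -
      have "(\<lambda>y. pY i (iY i y)) ` A k i = (\<lambda>y. y) ` A k i"
        by (rule image_cong[OF refl]) (use subA[of k i] pyi in blast)
      then show ?thesis by (simp add: image_image)
    qed
    have Bj: "B j = (\<lambda>i. iY i ` A j i)" "B (Suc j) = (\<lambda>i. iY i ` A (Suc j) i)"
      using that False by (simp_all add: B_def)
    have "A j = A (Suc j)" if "B j = B (Suc j)"
    proof
      fix i
      have "pY i ` iY i ` A j i = pY i ` iY i ` A (Suc j) i"
        using fun_cong[OF that, of i] unfolding Bj by simp
      then show "A j i = A (Suc j) i"
        unfolding retract .
    qed
    moreover have "B j \<le> B (Suc j)"
      using Aj unfolding Bj less_fun_def le_fun_def by (auto intro: image_mono)
    ultimately show ?thesis
      using Aj by (auto simp: order.strict_iff_order)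
  next
    case True
    obtain i where "\<not> zero_module (cobj Z i)"
      using nz zero_obj_iff[OF Z] by auto
    then obtain z where z: "z \<in> carrier (cobj Z i)" "z \<noteq> \<zero>\<^bsub>cobj Z i\<^esub>"
      by (rule not_zero_module[OF Z])
    have "iZ i z \<notin> iY i ` A ?n i"
    proof
      assume "iZ i z \<in> iY i ` A ?n i"
      then obtain y where y: "y \<in> carrier (cobj Y i)" "iZ i z = iY i y"
        using subA by auto
      then show False
        using pzi[OF z(1)] pzy[OF y(1)] z(2) by simp
    qed
    moreover have "iZ i z \<in> ?T i"
      by (rule chain_map_closed[OF c(2) z(1)])
    ultimately have "B j i \<noteq> ?T i"
      using True by (auto simp: B_def)
    then have "B j \<noteq> ?T" by metis
    then show ?thesis
      using graded_submodule_le_carrier[OF subB[of j]] True by (simp add: B_def)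
  qed
  then have "has_submodule_chain X (Suc ?n)"
    using subB by (auto simp: has_submodule_chain_def)
  then show ?thesis
    using composition_length(2)[OF fd CX, of "Suc ?n"] by simp
qed

section \<open>Existence of long indecomposable complexes is downward closed\<close>

text \<open>If no indecomposable in \<open>C\<^sub>n\<close> reaches both ends, then the indecomposable summands of \<open>T\<close> can be
  sorted into those that vanish at the left end, on which \<open>q\<close> is zero, and the others, which vanish at
  the right end and on which \<open>q\<close> is the identity. The induction on the composition length carries
  along \<open>q\<close> alone, so that no decomposition into more than two summands has to be written down.\<close>

lemma end_separating_idempotent:
  fixes scale :: "'k::field \<Rightarrow> 'a::ring_1 \<Rightarrow> 'a"
  assumes fd: "finite_dim_algebra scale" and m: "m0_cond TYPE('a) n" and T: "Cn n (T :: 'a cplx)"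
  shows "\<exists>q. idempotent T q \<and> (\<forall>x\<in>carrier (cobj T 1). q 1 x = x)
    \<and> (\<forall>x\<in>carrier (cobj T (int n)). q (int n) x = \<zero>\<^bsub>cobj T (int n)\<^esub>)"
  using T
proof (induction "composition_length T" arbitrary: T rule: less_induct)
  case less
  have T: "proj_complex T"
    using less.prems by (simp add: Cn_def)
  interpret right_module "cobj T i" for i
    by (rule proj_complex_module[OF T])
  have zero: "idempotent T (zero_map T)" and one: "idempotent T id_map"
    using chain_map_id[of T] chain_map_zero_map[OF T T] by (simp_all add: idempotent_def zero_map_def id_map_def)
  show ?case
  proof (cases "zero_module (cobj T 1) \<or> zero_module (cobj T (int n))")
    case True
    then show ?thesis
    proof
      assume "zero_module (cobj T 1)"
      then show ?thesis
        using zero by (intro exI[of _ "zero_map T"]) (simp add: zero_map_def zero_module_def)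
    next
      assume "zero_module (cobj T (int n))"
      then show ?thesis
        using one by (intro exI[of _ id_map]) (simp add: id_map_def zero_module_def)
    qed
  next
    case False
    then have "\<not> indecomposable_C T" "\<not> zero_obj map_eq T"
      using m less.prems zero_obj_iff[OF T] by (auto simp: m0_cond_def)
    then obtain Y Z where Y: "proj_complex Y" and Z: "proj_complex Z" and s: "direct_sum map_eq T Y Z"
      and nz: "\<not> zero_obj map_eq Y" "\<not> zero_obj map_eq Z"
      using T by (auto simp: indecomposable_def)
    have CY: "Cn n Y" and CZ: "Cn n Z"
      using less.prems Y Z zero_module_summands[OF T Y Z s] by (simp_all add: Cn_def)
    have "composition_length Y < composition_length T"
      by (rule composition_length_summand[OF fd Cn_imp_Cb[OF less.prems] Cn_imp_Cb[OF CY] Z s nz(2)])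
    from less.hyps[OF this CY] obtain q where q: "idempotent Y q"
      "\<And>x. x \<in> carrier (cobj Y 1) \<Longrightarrow> q 1 x = x"
      "\<And>x. x \<in> carrier (cobj Y (int n)) \<Longrightarrow> q (int n) x = \<zero>\<^bsub>cobj Y (int n)\<^esub>" by auto
    have "composition_length Z < composition_length T"
      by (rule composition_length_summand[OF fd Cn_imp_Cb[OF less.prems] Cn_imp_Cb[OF CZ] Y
            direct_sum_commute[OF T s] nz(1)])
    from less.hyps[OF this CZ] obtain q' where q': "idempotent Z q'"
      "\<And>x. x \<in> carrier (cobj Z 1) \<Longrightarrow> q' 1 x = x"
      "\<And>x. x \<in> carrier (cobj Z (int n)) \<Longrightarrow> q' (int n) x = \<zero>\<^bsub>cobj Z (int n)\<^esub>" by auto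
    obtain iY iZ pY pZ where b: "biproduct T Y Z iY iZ pY pZ"
      using s by (auto simp: direct_sum_map_eq_iff)
    note c = biproductD(1-4)[OF b]
    have cq: "chain_map Y Y q" "chain_map Z Z q'"
      using q q' by (simp_all add: idempotent_def)
    interpret Y: right_module "cobj Y i" for i by (rule proj_complex_module[OF Y])
    interpret Z: right_module "cobj Z i" for i by (rule proj_complex_module[OF Z])
    note cl = chain_map_closed[OF c(1)] chain_map_closed[OF c(2)] chain_map_closed[OF c(3)]
      chain_map_closed[OF c(4)] chain_map_closed[OF cq(1)] chain_map_closed[OF cq(2)]
    define p where "p = add_map T (comp_map iY (comp_map q pY)) (comp_map iZ (comp_map q' pZ))"
    have p: "p i x = iY i (q i (pY i x)) \<oplus>\<^bsub>cobj T i\<^esub> iZ i (q' i (pZ i x))" for i x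
      by (simp add: p_def add_map_def comp_map_def)
    have "chain_map T T p"
      unfolding p_def by (rule chain_map_add_map[OF T chain_map_comp[OF chain_map_comp[OF c(3) cq(1)] c(1)]
            chain_map_comp[OF chain_map_comp[OF c(4) cq(2)] c(2)]])
    moreover have "p i (p i x) = p i x" if x: "x \<in> carrier (cobj T i)" for i x
    proof -
      have pp: "pY i (p i x) = q i (pY i x)" "pZ i (p i x) = q' i (pZ i x)"
        unfolding p using x by (simp_all add: chain_map_add[OF c(3)] chain_map_add[OF c(4)] cl biproductD(5-8)[OF b])
      have "p i (p i x) = iY i (q i (q i (pY i x))) \<oplus>\<^bsub>cobj T i\<^esub> iZ i (q' i (q' i (pZ i x)))"
        unfolding p[of i "p i x"] pp ..
      then show ?thesis
        using q(1) q'(1) x unfolding p[of i x] by (simp add: idempotent_def cl)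
    qed
    ultimately have "idempotent T p"
      by (simp add: idempotent_def)
    moreover have "p 1 x = x" if "x \<in> carrier (cobj T 1)" for x
      unfolding p using that by (simp add: q(2) q'(2) cl biproductD(9)[OF b])
    moreover have "p (int n) x = \<zero>\<^bsub>cobj T (int n)\<^esub>" if "x \<in> carrier (cobj T (int n))" for x
      unfolding p using that
      by (simp add: q(3) q'(3) cl chain_map_zero[OF Y T c(1)] chain_map_zero[OF Z T c(2)])
    ultimately show ?thesis by blast
  qed
qed

definition truncate :: "int \<Rightarrow> 'a::ring_1 cplx \<Rightarrow> 'a cplx" where
  "truncate n X =
    \<lparr>cobj = \<lambda>i. if i \<le> n then cobj X i else (cobj X i)\<lparr>carrier := {\<zero>\<^bsub>cobj X i\<^esub>}\<rparr>,
     cdiff = \<lambda>i. if i < n then cdiff X i else (\<lambda>x. \<zero>\<^bsub>cobj X (i + 1)\<^esub>)\<rparr>"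

lemma proj_complex_truncate:
  assumes X: "proj_complex X"
  shows "proj_complex (truncate n X)"
proof -
  have proj: "proj_module (cobj (truncate n X) i)" for i
    using X proj_module_zero by (auto simp: truncate_def proj_complex_def)
  have zero: "\<zero>\<^bsub>cobj (truncate n X) i\<^esub> = \<zero>\<^bsub>cobj X i\<^esub>" for i
    by (simp add: truncate_def)
  have hom: "cdiff (truncate n X) i \<in> rmod_hom (cobj (truncate n X) i) (cobj (truncate n X) (i + 1))" for i
  proof (cases "i < n")
    case True
    then show ?thesis using cdiff_hom[OF X, of i] by (simp add: truncate_def)
  next
    case False
    then have "cdiff (truncate n X) i = (\<lambda>x. \<zero>\<^bsub>cobj (truncate n X) (i + 1)\<^esub>)"
      by (simp add: truncate_def)
    then show ?thesis
      using rmod_hom_zero_map[OF proj_module_right_module[OF proj]] by simp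
  qed
  have "cdiff (truncate n X) (i + 1) (cdiff (truncate n X) i x) = \<zero>\<^bsub>cobj (truncate n X) (i + 2)\<^esub>"
    if x: "x \<in> carrier (cobj (truncate n X) i)" for i x
    using x cdiff_cdiff[OF X, of x i] unfolding zero
    by (auto simp: truncate_def add.commute split: if_splits)
  then show ?thesis
    using proj hom by (simp add: proj_complex_def)
qed

text \<open>Let \<open>X\<close> reach both ends of \<open>C\<^bsub>n+1\<^esub>\<close>, and cut off its last term. The idempotent of the
  truncation that separates the two ends vanishes in degree \<open>n\<close>, so it extends by zero to a chain
  endomorphism of \<open>X\<close>. It is the identity in degree \<open>1\<close> and zero in degree \<open>n + 1\<close>, which
  contradicts indecomposability.\<close>

lemma m0_cond_Suc:
  fixes scale :: "'k::field \<Rightarrow> 'a::ring_1 \<Rightarrow> 'a"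
  assumes fd: "finite_dim_algebra scale" and n: "1 \<le> n" and m: "m0_cond TYPE('a) n"
  shows "m0_cond TYPE('a) (Suc n)"
  unfolding m0_cond_def
proof (intro allI impI, elim conjE, rule ccontr)
  fix X :: "'a cplx"
  assume CX: "Cn (Suc n) X" and ind: "indecomposable_C X"
    and nz: "\<not> (zero_module (cobj X 1) \<or> zero_module (cobj X (int (Suc n))))"
  have X: "proj_complex X"
    using CX by (simp add: Cn_def)
  let ?T = "truncate (int n) X"
  have low: "cobj ?T i = cobj X i" if "i \<le> int n" for i
    using that by (simp add: truncate_def)
  have "zero_module (cobj ?T i)" if "i \<notin> {1..int n}" for i
    using that CX by (auto simp: truncate_def Cn_def zero_module_def)
  then have "Cn n ?T"
    using proj_complex_truncate[OF X] by (simp add: Cn_def)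
  from end_separating_idempotent[OF fd m this] obtain q where q: "idempotent ?T q"
    and q1: "\<And>x. x \<in> carrier (cobj X 1) \<Longrightarrow> q 1 x = x"
    and qn: "\<And>x. x \<in> carrier (cobj X (int n)) \<Longrightarrow> q (int n) x = \<zero>\<^bsub>cobj X (int n)\<^esub>"
    using n low[of 1] low[of "int n"] by auto
  have cq: "chain_map ?T ?T q"
    using q by (simp add: idempotent_def)
  define e where "e i = (if i \<le> int n then q i else (\<lambda>x. \<zero>\<^bsub>cobj X i\<^esub>))" for i
  have "chain_map X X e"
  proof (rule chain_mapI)
    fix i
    show "e i \<in> rmod_hom (cobj X i) (cobj X i)"
      using chain_map_hom[OF cq, of i] low[of i] rmod_hom_zero_map[OF proj_complex_module[OF X]]
      by (cases "i \<le> int n") (simp_all add: e_def)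
    fix x assume x: "x \<in> carrier (cobj X i)"
    consider "i < int n" | "i = int n" | "i > int n" by linarith
    then show "cdiff X i (e i x) = e (i + 1) (cdiff X i x)"
    proof cases
      case 1
      then have "cdiff ?T i = cdiff X i"
        by (simp add: truncate_def)
      then show ?thesis
        using chain_map_comm[OF cq, of x i] 1 x low[of i] by (simp add: e_def)
    qed (use x qn cdiff_zero[OF X, of i] in \<open>simp_all add: e_def\<close>)
  qed
  moreover have "e i (e i x) = e i x" if "x \<in> carrier (cobj X i)" for i x
    using that q low[of i] by (auto simp: e_def idempotent_def)
  ultimately have "idempotent X e"
    by (simp add: idempotent_def)
  from indecomposable_idempotent_trivial[OF ind this] show False
  proof
    assume z: "\<forall>i. \<forall>x\<in>carrier (cobj X i). e i x = \<zero>\<^bsub>cobj X i\<^esub>"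
    obtain x where x: "x \<in> carrier (cobj X 1)" "x \<noteq> \<zero>\<^bsub>cobj X 1\<^esub>"
      using nz not_zero_module[OF X] by blast
    then show False
      using z[rule_format, OF x(1)] q1[OF x(1)] n by (simp add: e_def)
  next
    assume one: "\<forall>i. \<forall>x\<in>carrier (cobj X i). e i x = x"
    obtain x where x: "x \<in> carrier (cobj X (int (Suc n)))" "x \<noteq> \<zero>\<^bsub>cobj X (int (Suc n))\<^esub>"
      using nz not_zero_module[OF X] by blast
    then show False
      using one[rule_format, OF x(1)] by (simp add: e_def)
  qed
qed

section \<open>From the category of complexes to the homotopy category\<close>

lemma homotopic_sandwich:
  assumes "proj_complex X" "proj_complex Y" "proj_complex Z" "chain_map W X l"
    and "chain_map X Y g" "chain_map Y Z k" "homotopic X Y f g"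
  shows "homotopic W Z (\<lambda>i x. k i (f i (l i x))) (\<lambda>i x. k i (g i (l i x)))"
  using homotopic_comp_right[OF assms(4) homotopic_comp_left[OF assms(1-3,5,6,7)]]
  by (simp add: comp_map_def)

lemma contracting_homotopy:
  assumes "proj_complex X" "contractible X"
  shows "\<exists>h. htpy X X h \<and> (\<forall>i. \<forall>x\<in>carrier (cobj X i).
    x = cdiff X (i - 1) (h i x) \<oplus>\<^bsub>cobj X i\<^esub> h (i + 1) (cdiff X i x))"
proof -
  interpret right_module "cobj X i" for i
    by (rule proj_complex_module[OF assms(1)])
  obtain h where h: "htpy X X h"
    and eq: "\<And>i x. x \<in> carrier (cobj X i) \<Longrightarrow> x = \<zero>\<^bsub>cobj X i\<^esub> \<oplus>\<^bsub>cobj X i\<^esub> htpy_sum X X h i x"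
    using assms(2) by (auto simp: zero_obj_def homotopic_iff id_map_def zero_map_def)
  have "x = cdiff X (i - 1) (h i x) \<oplus>\<^bsub>cobj X i\<^esub> h (i + 1) (cdiff X i x)"
    if "x \<in> carrier (cobj X i)" for i x
    using eq[OF that] htpy_sum_closed[OF assms(1,1) h that] by (simp add: htpy_sum_def)
  then show ?thesis
    using h by blast
qed

text \<open>A contracting homotopy splits off the summand \<open>X\<^sup>1 \<rightarrow> d(X\<^sup>1)\<close>, on which \<open>d\<close> is an isomorphism:
  the idempotent is the identity in degree \<open>1\<close> and \<open>d h\<close> in degree \<open>2\<close>. It misses the last term as
  soon as \<open>n \<ge> 3\<close>. For \<open>n = 2\<close> the identity \<open>P \<rightarrow> P\<close> of an indecomposable projective module is a
  counterexample.\<close>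

lemma contractible_indecomposable_narrow:
  assumes ind: "indecomposable_C X" and CX: "Cn n X" and n: "3 \<le> n" and con: "contractible X"
  shows "zero_module (cobj X 1) \<or> zero_module (cobj X (int n))"
proof (rule ccontr)
  assume nz: "\<not> (zero_module (cobj X 1) \<or> zero_module (cobj X (int n)))"
  have X: "proj_complex X"
    using CX by (simp add: Cn_def)
  interpret right_module "cobj X i" for i
    by (rule proj_complex_module[OF X])
  obtain h where h: "htpy X X h" and eq: "\<forall>i. \<forall>x\<in>carrier (cobj X i).
      x = cdiff X (i - 1) (h i x) \<oplus>\<^bsub>cobj X i\<^esub> h (i + 1) (cdiff X i x)"
    using contracting_homotopy[OF X con] by blast
  have "zero_module (cobj X 0)"
    using CX by (simp add: Cn_def)
  then have h1: "h 1 y = \<zero>\<^bsub>cobj X 0\<^esub>" if "y \<in> carrier (cobj X 1)" for y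
    using rmod_hom_closed[OF htpy_hom[OF h] that] by (simp add: zero_module_def)
  have hd1: "h 2 (cdiff X 1 y) = y" if y: "y \<in> carrier (cobj X 1)" for y
    using eq[rule_format, OF y] h1[OF y] cdiff_zero[OF X, of 0] rmod_hom_closed[OF htpy_hom_succ[OF h] cdiff_closed[OF X y]]
    by simp
  have h2: "h 2 y \<in> carrier (cobj X 1)" if "y \<in> carrier (cobj X 2)" for y
    using rmod_hom_closed[OF htpy_hom[OF h] that] by simp
  define p where "p i = (if i \<le> 1 then (\<lambda>x. x) else if i = 2 then (\<lambda>x. cdiff X 1 (h 2 x))
    else (\<lambda>x. \<zero>\<^bsub>cobj X i\<^esub>))" for i
  have "chain_map X X p"
  proof (rule chain_mapI)
    fix i
    have "(\<lambda>x. cdiff X 1 (h 2 x)) \<in> rmod_hom (cobj X 2) (cobj X 2)"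
      using rmod_hom_comp[OF htpy_hom[OF h, of 2] cdiff_hom[OF X, of "2 - 1"]] by simp
    then show "p i \<in> rmod_hom (cobj X i) (cobj X i)"
      by (auto simp: p_def intro: rmod_hom_id rmod_hom_zero_map[OF proj_complex_module[OF X]])
    fix x assume x: "x \<in> carrier (cobj X i)"
    consider "i \<le> 0" | "i = 1" | "i = 2" | "i > 2" by linarith
    then show "cdiff X i (p i x) = p (i + 1) (cdiff X i x)"
    proof cases
      case 2
      then show ?thesis using hd1 x by (simp add: p_def)
    next
      case 3
      then show ?thesis using cdiff_cdiff[OF X h2, of x] x by (simp add: p_def)
    qed (simp_all add: p_def cdiff_zero[OF X])
  qed
  moreover have "p i (p i x) = p i x" if x: "x \<in> carrier (cobj X i)" for i x
    using x hd1[OF h2, of x] by (auto simp: p_def)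
  ultimately have "idempotent X p"
    by (simp add: idempotent_def)
  from indecomposable_idempotent_trivial[OF ind this] show False
  proof
    assume z: "\<forall>i. \<forall>x\<in>carrier (cobj X i). p i x = \<zero>\<^bsub>cobj X i\<^esub>"
    obtain x where x: "x \<in> carrier (cobj X 1)" "x \<noteq> \<zero>\<^bsub>cobj X 1\<^esub>"
      using nz not_zero_module[OF X] by blast
    then show False
      using z[rule_format, OF x(1)] by (simp add: p_def)
  next
    assume one: "\<forall>i. \<forall>x\<in>carrier (cobj X i). p i x = x"
    obtain x where x: "x \<in> carrier (cobj X (int n))" "x \<noteq> \<zero>\<^bsub>cobj X (int n)\<^esub>"
      using nz not_zero_module[OF X] by blast
    then show False
      using one[rule_format, OF x(1)] n by (simp add: p_def)
  qed
qed

text \<open>If \<open>X\<close> had a nonzero contractible summand \<open>Y\<close>, the other summand would be zero by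
  indecomposability. The identity of \<open>X\<close> would then factor through \<open>Y\<close> and be null-homotopic.\<close>

lemma indecomposable_reduced:
  assumes CX: "Cb X" and ind: "indecomposable_C X" and ncon: "\<not> contractible X"
  shows "reduced X"
  unfolding reduced_def
proof (intro conjI allI impI CX, elim conjE)
  fix Y Z assume CY: "Cb Y" and CZ: "Cb Z" and s: "direct_sum map_eq X Y Z" and cY: "contractible Y"
  have X: "proj_complex X" and Y: "proj_complex Y" and Z: "proj_complex Z"
    using CX CY CZ by (simp_all add: Cb_def)
  interpret right_module "cobj X i" for i
    by (rule proj_complex_module[OF X])
  obtain iY iZ pY pZ where b: "biproduct X Y Z iY iZ pY pZ"
    using s by (auto simp: direct_sum_map_eq_iff)
  note c = biproductD(1-4)[OF b]
  show "zero_obj map_eq Y"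
  proof (rule ccontr)
    assume "\<not> zero_obj map_eq Y"
    then have zZ: "zero_obj map_eq Z"
      using indecomposableD[OF ind Y Z s] by simp
    have eq: "iY i (pY i x) = x" if x: "x \<in> carrier (cobj X i)" for i x
    proof -
      have "pZ i x = \<zero>\<^bsub>cobj Z i\<^esub>"
        using zZ chain_map_closed[OF c(4) x] zero_obj_iff[OF Z] by (auto simp: zero_module_def)
      then show ?thesis
        using biproductD(9)[OF b x] chain_map_closed[OF c(1) chain_map_closed[OF c(3) x]]
          chain_map_zero[OF Z X c(2)] by simp
    qed
    have "homotopic X X id_map (comp_map iY pY)"
      using eq by (intro homotopicI_map_eq[OF X X chain_map_comp[OF c(3,1)]])
        (simp add: map_eq_def id_map_def comp_map_def)
    moreover have "homotopic X X (comp_map iY pY) (\<lambda>i x. iY i (zero_map Y i (pY i x)))"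
      using homotopic_sandwich[OF Y Y X c(3) chain_map_zero_map[OF Y Y] c(1) cY[unfolded zero_obj_def]]
      by (simp add: id_map_def comp_map_def)
    moreover have "(\<lambda>i x. iY i (zero_map Y i (pY i x))) = zero_map X"
      using chain_map_zero[OF Y X c(1)] by (simp add: zero_map_def)
    ultimately have "homotopic X X id_map (zero_map X)"
      using homotopic_trans[OF X X chain_map_zero_map[OF X X]] by simp
    then show False
      using ncon by (simp add: zero_obj_def)
  qed
qed

text \<open>A decomposition in the homotopy category gives a chain endomorphism \<open>e\<close> that is idempotent
  only up to homotopy. By Fitting's lemma \<open>e\<close> is nilpotent or invertible in the category of
  complexes. As \<open>e\<close> is homotopic to its powers, it is then homotopic to \<open>0\<close> or to the identity.\<close>

lemma indecomposable_C_imp_Kb: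
  fixes scale :: "'k::field \<Rightarrow> 'a::ring_1 \<Rightarrow> 'a"
  assumes fd: "finite_dim_algebra scale" and CX: "Cb (X :: 'a cplx)" and ind: "indecomposable_C X"
    and ncon: "\<not> contractible X"
  shows "indecomposable_Kb X"
  unfolding indecomposable_def
proof (intro conjI allI impI CX ncon, elim conjE)
  fix Y Z assume CY: "Cb Y" and CZ: "Cb Z" and s: "direct_sum homotopic X Y Z"
  have X: "proj_complex X" and Y: "proj_complex Y" and Z: "proj_complex Z"
    using CX CY CZ by (simp_all add: Cb_def)
  obtain iY iZ pY pZ where c: "chain_map Y X iY" "chain_map Z X iZ" "chain_map X Y pY" "chain_map X Z pZ"
    and hY: "homotopic Y Y (comp_map pY iY) id_map" and hZ: "homotopic Z Z (comp_map pZ iZ) id_map"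
    and hZY: "homotopic Z Y (comp_map pY iZ) (zero_map Y)"
    using s by (auto simp: direct_sum_def)
  define e where "e = comp_map iY pY"
  have e: "chain_map X X e"
    unfolding e_def by (rule chain_map_comp[OF c(3,1)])
  have ee: "homotopic X X (comp_map e e) e"
    using homotopic_sandwich[OF Y Y X c(3) chain_map_id c(1) hY]
    by (simp add: e_def comp_map_def id_map_def)
  have pow: "homotopic X X (\<lambda>i. e i ^^ Suc m) e" for m
  proof (induction m)
    case 0
    then show ?case using homotopic_refl[OF X X e] by (simp add: comp_def)
  next
    case (Suc m)
    have "homotopic X X (comp_map e (\<lambda>i. e i ^^ Suc m)) (comp_map e e)"
      by (rule homotopic_comp_left[OF X X X e e Suc.IH])
    then have "homotopic X X (comp_map e (\<lambda>i. e i ^^ Suc m)) e"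
      by (rule homotopic_trans[OF X X e _ ee])
    then show ?case by (simp add: comp_map_def comp_def)
  qed
  obtain N where "N > 0" and N: "(\<forall>i. \<forall>x\<in>carrier (cobj X i). (e i ^^ N) x = \<zero>\<^bsub>cobj X i\<^esub>)
    \<or> (\<exists>g. chain_map X X g \<and> (\<forall>i. \<forall>x\<in>carrier (cobj X i). g i ((e i ^^ N) x) = x))"
    using indecomposable_fitting[OF fd CX ind e] by blast
  then obtain m where m: "N = Suc m"
    by (cases N) auto
  note powc = chain_map_pow[OF e]
  show "contractible Y \<or> contractible Z"
    using N
  proof
    assume nil: "\<forall>i. \<forall>x\<in>carrier (cobj X i). (e i ^^ N) x = \<zero>\<^bsub>cobj X i\<^esub>"
    note z = chain_map_zero_map[OF X X] and zY = chain_map_zero_map[OF Y Y]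
    have "homotopic X X (\<lambda>i. e i ^^ N) (zero_map X)"
      using nil by (intro homotopicI_map_eq[OF X X z]) (simp add: map_eq_def zero_map_def)
    then have "homotopic X X e (zero_map X)"
      using homotopic_trans[OF X X z homotopic_sym[OF X X e pow[of m]]] by (simp add: m)
    then have "homotopic Y Y (\<lambda>i y. pY i (e i (iY i y))) (\<lambda>i y. pY i (zero_map X i (iY i y)))"
      by (rule homotopic_sandwich[OF X X Y c(1) z c(3)])
    moreover have "(\<lambda>i y. pY i (zero_map X i (iY i y))) = zero_map Y"
      using chain_map_zero[OF X Y c(3)] by (simp add: zero_map_def)
    moreover have "(\<lambda>i y. pY i (e i (iY i y))) = comp_map (comp_map pY iY) (comp_map pY iY)"
      by (simp add: e_def comp_map_def)
    ultimately have 0: "homotopic Y Y (comp_map (comp_map pY iY) (comp_map pY iY)) (zero_map Y)"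
      by simp
    \<comment> \<open>The identity of \<open>Y\<close> is homotopic to \<open>pY iY\<close>, hence to \<open>(pY iY)(pY iY) = pY e iY\<close>, and so to zero.\<close>
    let ?a = "comp_map pY iY"
    have a: "chain_map Y Y ?a"
      by (rule chain_map_comp[OF c(1,3)])
    have "homotopic Y Y (comp_map ?a ?a) (comp_map ?a id_map)"
      by (rule homotopic_comp_left[OF Y Y Y chain_map_id a hY])
    then have "homotopic Y Y (comp_map ?a ?a) ?a"
      by (simp add: comp_map_def id_map_def)
    then have "homotopic Y Y (comp_map ?a ?a) id_map"
      by (rule homotopic_trans[OF Y Y chain_map_id _ hY])
    then have "homotopic Y Y id_map (comp_map ?a ?a)"
      by (rule homotopic_sym[OF Y Y chain_map_id])
    then have "homotopic Y Y id_map (zero_map Y)"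
      by (rule homotopic_trans[OF Y Y zY _ 0])
    then show ?thesis
      by (simp add: zero_obj_def)
  next
    assume "\<exists>g. chain_map X X g \<and> (\<forall>i. \<forall>x\<in>carrier (cobj X i). g i ((e i ^^ N) x) = x)"
    then obtain g where g: "chain_map X X g"
      and gN: "\<And>i x. x \<in> carrier (cobj X i) \<Longrightarrow> g i ((e i ^^ N) x) = x" by auto
    have "homotopic X X (\<lambda>i. e i ^^ N) (\<lambda>i. e i ^^ Suc N)"
      using homotopic_trans[OF X X powc pow[of m] homotopic_sym[OF X X e pow[of N]]]
      by (simp add: m)
    from homotopic_comp_left[OF X X X powc g this]
    have "homotopic X X (comp_map g (\<lambda>i. e i ^^ N)) (comp_map g (\<lambda>i. e i ^^ Suc N))" .
    moreover have "homotopic X X id_map (comp_map g (\<lambda>i. e i ^^ N))"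
      using gN by (intro homotopicI_map_eq[OF X X chain_map_comp[OF powc g]])
        (simp add: map_eq_def id_map_def comp_map_def)
    moreover have "homotopic X X (comp_map g (\<lambda>i. e i ^^ Suc N)) e"
      using gN chain_map_closed[OF e] by (intro homotopicI_map_eq[OF X X e])
        (simp add: map_eq_def comp_map_def funpow_swap1)
    ultimately have id_e: "homotopic X X id_map e"
      using homotopic_trans[OF X X e] homotopic_trans[OF X X chain_map_comp[OF powc g]] by blast
    \<comment> \<open>The identity of \<open>Z\<close> is homotopic to \<open>pZ iZ\<close>, hence to \<open>pZ e iZ = (pZ iY)(pY iZ)\<close>, and \<open>pY iZ\<close> is null-homotopic.\<close>
    note zZ = chain_map_zero_map[OF Z Z]
    have "homotopic Z Z id_map (comp_map pZ iZ)"
      by (rule homotopic_sym[OF Z Z chain_map_id hZ])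
    moreover have "homotopic Z Z (comp_map pZ iZ) (\<lambda>i z. pZ i (e i (iZ i z)))"
      using homotopic_sandwich[OF X X Z c(2) e c(4) id_e] by (simp add: comp_map_def id_map_def)
    moreover have "homotopic Z Z (\<lambda>i z. pZ i (e i (iZ i z))) (zero_map Z)"
    proof -
      have "homotopic Z Z (comp_map (comp_map pZ iY) (comp_map pY iZ)) (comp_map (comp_map pZ iY) (zero_map Y))"
        by (rule homotopic_comp_left[OF Z Y Z chain_map_zero_map[OF Z Y] chain_map_comp[OF c(1,4)] hZY])
      moreover have "comp_map (comp_map pZ iY) (zero_map Y) = zero_map Z"
        using chain_map_zero[OF Y X c(1)] chain_map_zero[OF X Z c(4)] by (simp add: comp_map_def zero_map_def)
      ultimately show ?thesis by (simp add: comp_map_def e_def)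
    qed
    moreover have "chain_map Z Z (\<lambda>i z. pZ i (e i (iZ i z)))"
      using chain_map_comp[OF chain_map_comp[OF c(2) e] c(4)] by (simp add: comp_map_def)
    ultimately have "homotopic Z Z id_map (zero_map Z)"
      using homotopic_trans[OF Z Z zZ homotopic_trans[OF Z Z _ ]] by blast
    then show ?thesis
      by (simp add: zero_obj_def)
  qed
qed

lemma indecomposable_Kb_of_width:
  fixes scale :: "'k::field \<Rightarrow> 'a::ring_1 \<Rightarrow> 'a"
  assumes fd: "finite_dim_algebra scale" and n: "3 \<le> n" and m: "\<not> m0_cond TYPE('a) n"
  shows "\<exists>X :: 'a cplx. indecomposable_Kb X \<and> has_length X (n - 1)"
proof -
  obtain X :: "'a cplx" where CX: "Cn n X" and ind: "indecomposable_C X"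
    and nz: "\<not> zero_module (cobj X 1)" "\<not> zero_module (cobj X (int n))"
    using m by (auto simp: m0_cond_def)
  have ncon: "\<not> contractible X"
    using contractible_indecomposable_narrow[OF ind CX n] nz by auto
  have X: "proj_complex X"
    using CX by (simp add: Cn_def)
  note CbX = Cn_imp_Cb[OF CX]
  have id_id: "comp_map id_map id_map = (id_map :: 'a cmap)"
    by (simp add: comp_map_def id_map_def)
  have "iso_obj homotopic X X"
    unfolding iso_obj_def
    by (intro exI[of _ id_map] conjI) (simp_all only: id_id chain_map_id homotopic_refl[OF X X chain_map_id])
  then have "has_length X (n - 1)"
    unfolding has_length_def using indecomposable_reduced[OF CbX ind ncon] nz CX n
    by (intro exI[of _ X] exI[of _ 1] exI[of _ "int n"]) (auto simp: Cn_def)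
  then show ?thesis
    using indecomposable_C_imp_Kb[OF fd CbX ind ncon] by blast
qed

section \<open>From the homotopy category to the category of complexes\<close>

text \<open>The usual sign of the shifted differential is omitted: the complexes with and without it
  are isomorphic, and only the positions of the terms are at stake.\<close>

definition shift :: "int \<Rightarrow> 'a::ring_1 cplx \<Rightarrow> 'a cplx" where
  "shift k X = \<lparr>cobj = \<lambda>i. cobj X (i + k), cdiff = \<lambda>i. cdiff X (i + k)\<rparr>"

lemma shift_simps [simp]:
  "cobj (shift k X) i = cobj X (i + k)" "cdiff (shift k X) i = cdiff X (i + k)"
  by (simp_all add: shift_def)

lemma shift_inverse: "shift k (shift (- k) X) = X" "shift (- k) (shift k X) = X"
  by (simp_all add: shift_def)

lemma proj_complex_shift:
  assumes "proj_complex X"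
  shows "proj_complex (shift k X)"
  unfolding proj_complex_def
proof (intro conjI allI ballI)
  fix i
  have index: "i + 1 + k = i + k + 1" "i + 2 + k = i + k + 2"
    by simp_all
  show "proj_module (cobj (shift k X) i)"
    using assms by (simp add: proj_complex_def)
  show "cdiff (shift k X) i \<in> rmod_hom (cobj (shift k X) i) (cobj (shift k X) (i + 1))"
    unfolding shift_simps index by (rule cdiff_hom[OF assms])
  fix x assume "x \<in> carrier (cobj (shift k X) i)"
  then show "cdiff (shift k X) (i + 1) (cdiff (shift k X) i x) = \<zero>\<^bsub>cobj (shift k X) (i + 2)\<^esub>"
    unfolding shift_simps index by (rule cdiff_cdiff[OF assms])
qed

lemma chain_map_shift:
  assumes "chain_map X Y f"
  shows "chain_map (shift k X) (shift k Y) (\<lambda>i. f (i + k))"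
proof (rule chain_mapI)
  fix i x assume "x \<in> carrier (cobj (shift k X) i)"
  then show "cdiff (shift k Y) i (f (i + k) x) = f (i + 1 + k) (cdiff (shift k X) i x)"
    using chain_map_comm[OF assms, of x "i + k"] by (simp add: algebra_simps)
qed (simp add: chain_map_hom[OF assms])

lemma direct_sum_shift:
  "direct_sum map_eq X Y Z \<Longrightarrow> direct_sum map_eq (shift k X) (shift k Y) (shift k Z)"
  unfolding direct_sum_map_eq_iff
proof (elim exE)
  fix iY iZ pY pZ assume "biproduct X Y Z iY iZ pY pZ"
  then have "biproduct (shift k X) (shift k Y) (shift k Z) (\<lambda>i. iY (i + k)) (\<lambda>i. iZ (i + k))
      (\<lambda>i. pY (i + k)) (\<lambda>i. pZ (i + k))"
    by (simp add: biproduct_def chain_map_shift)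
  then show "\<exists>iY iZ pY pZ. biproduct (shift k X) (shift k Y) (shift k Z) iY iZ pY pZ"
    by blast
qed

lemma zero_obj_shift: "proj_complex X \<Longrightarrow> zero_obj map_eq (shift k X) \<Longrightarrow> zero_obj map_eq X"
  unfolding zero_obj_iff[OF proj_complex_shift] zero_obj_iff
  by (metis shift_simps(1) diff_add_cancel)

lemma indecomposable_C_shift:
  assumes "indecomposable_C X"
  shows "indecomposable_C (shift k X)"
proof -
  have X: "proj_complex X" and nz: "\<not> zero_obj map_eq X"
    using assms by (simp_all add: indecomposable_def)
  have "zero_obj map_eq Y \<or> zero_obj map_eq Z"
    if Y: "proj_complex Y" and Z: "proj_complex Z" and s: "direct_sum map_eq (shift k X) Y Z" for Y Z
  proof -
    have "direct_sum map_eq X (shift (- k) Y) (shift (- k) Z)"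
      using direct_sum_shift[OF s, of "- k"] by (simp add: shift_inverse)
    then have "zero_obj map_eq (shift (- k) Y) \<or> zero_obj map_eq (shift (- k) Z)"
      using indecomposableD[OF assms proj_complex_shift[OF Y] proj_complex_shift[OF Z]] by simp
    then show ?thesis
      using zero_obj_shift Y Z by blast
  qed
  then show ?thesis
    using proj_complex_shift[OF X] nz zero_obj_shift[OF X] unfolding indecomposable_def by blast
qed

lemma direct_sum_homotopic_iso:
  assumes X: "proj_complex X" and X': "proj_complex X'" and Y: "proj_complex Y" and Z: "proj_complex Z"
    and iso: "iso_obj homotopic X X'" and s: "direct_sum map_eq X' Y Z"
  shows "direct_sum homotopic X Y Z"
proof -
  obtain f g where f: "chain_map X X' f" and g: "chain_map X' X g"
    and gf: "homotopic X X (comp_map g f) id_map" and fg: "homotopic X' X' (comp_map f g) id_map"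
    using iso by (auto simp: iso_obj_def)
  obtain iY iZ pY pZ where b: "biproduct X' Y Z iY iZ pY pZ"
    using s by (auto simp: direct_sum_map_eq_iff)
  note c = biproductD(1-4)[OF b]
  have cancel: "homotopic V W (comp_map (comp_map p f) (comp_map g i)) k"
    if V: "proj_complex V" and W: "proj_complex W" and p: "chain_map X' W p" and i: "chain_map V X' i"
      and k: "chain_map V W k" and pi: "\<And>j v. v \<in> carrier (cobj V j) \<Longrightarrow> p j (i j v) = k j v"
    for V W p i k
  proof -
    have "homotopic V W (comp_map (comp_map p f) (comp_map g i)) (\<lambda>j v. p j (i j v))"
      using homotopic_sandwich[OF X' X' W i chain_map_id p fg] by (simp add: comp_map_def id_map_def)
    moreover have "homotopic V W (\<lambda>j v. p j (i j v)) k"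
      using pi by (intro homotopicI_map_eq[OF V W k]) (simp add: map_eq_def)
    ultimately show ?thesis
      using homotopic_trans[OF V W k] by blast
  qed
  have "homotopic X X (add_map X (comp_map (comp_map g iY) (comp_map pY f))
      (comp_map (comp_map g iZ) (comp_map pZ f))) (comp_map g f)"
  proof (rule homotopicI_map_eq[OF X X chain_map_comp[OF f g]])
    have "g i (iY i (pY i y)) \<oplus>\<^bsub>cobj X i\<^esub> g i (iZ i (pZ i y)) = g i y"
      if y: "y \<in> carrier (cobj X' i)" for i y
      using biproductD(9)[OF b y]
        chain_map_add[OF g chain_map_closed[OF c(1) chain_map_closed[OF c(3) y]]
          chain_map_closed[OF c(2) chain_map_closed[OF c(4) y]]] by simp
    then show "map_eq X X (add_map X (comp_map (comp_map g iY) (comp_map pY f))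
      (comp_map (comp_map g iZ) (comp_map pZ f))) (comp_map g f)"
      using chain_map_closed[OF f] by (simp add: map_eq_def add_map_def comp_map_def)
  qed
  then have "homotopic X X (add_map X (comp_map (comp_map g iY) (comp_map pY f))
      (comp_map (comp_map g iZ) (comp_map pZ f))) id_map"
    by (rule homotopic_trans[OF X X chain_map_id _ gf])
  moreover have "homotopic Y Y (comp_map (comp_map pY f) (comp_map g iY)) id_map"
    "homotopic Z Z (comp_map (comp_map pZ f) (comp_map g iZ)) id_map"
    "homotopic Z Y (comp_map (comp_map pY f) (comp_map g iZ)) (zero_map Y)"
    "homotopic Y Z (comp_map (comp_map pZ f) (comp_map g iY)) (zero_map Z)"
    by (rule cancel[OF Y Y c(3,1) chain_map_id] cancel[OF Z Z c(4,2) chain_map_id]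
        cancel[OF Z Y c(3,2) chain_map_zero_map[OF Z Y]] cancel[OF Y Z c(4,1) chain_map_zero_map[OF Y Z]],
      simp add: biproductD(5-8)[OF b] id_map_def zero_map_def)+
  ultimately show ?thesis
    unfolding direct_sum_def
    using chain_map_comp[OF c(1) g] chain_map_comp[OF c(2) g] chain_map_comp[OF f c(3)]
      chain_map_comp[OF f c(4)] by blast
qed

text \<open>A decomposition of the representative is one of \<open>X\<close> in the homotopy category, where one of
  the summands vanishes; being contractible, this summand is already zero as a complex because the
  representative is reduced.\<close>

lemma reduced_representative_indecomposable:
  assumes ind: "indecomposable_Kb X" and red: "reduced X'" and iso: "iso_obj homotopic X X'"
    and nz: "\<not> zero_obj map_eq X'"
  shows "indecomposable_C X'"
  unfolding indecomposable_def
proof (intro conjI allI impI nz)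
  have "Cb X" and CX': "Cb X'"
    using ind red by (simp_all add: indecomposable_def reduced_def)
  then have X: "proj_complex X" and X': "proj_complex X'"
    by (simp_all add: Cb_def)
  show "proj_complex X'" by (rule X')
  fix Y Z assume "proj_complex Y \<and> proj_complex Z \<and> direct_sum map_eq X' Y Z"
  then have Y: "proj_complex Y" and Z: "proj_complex Z" and s: "direct_sum map_eq X' Y Z"
    by simp_all
  have CY: "Cb Y" and CZ: "Cb Z"
    using CX' Y Z zero_module_summands[OF X' Y Z s] unfolding Cb_def by blast+
  have "contractible Y \<or> contractible Z"
    by (rule indecomposableD[OF ind CY CZ direct_sum_homotopic_iso[OF X X' Y Z iso s]])
  then show "zero_obj map_eq Y \<or> zero_obj map_eq Z"
    using red CY CZ s direct_sum_commute[OF X' s] unfolding reduced_def by blast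
qed

lemma width_of_indecomposable_Kb:
  fixes X :: "'a::ring_1 cplx"
  assumes ind: "indecomposable_Kb X" and len: "has_length X l"
  shows "\<not> m0_cond TYPE('a) (Suc l)"
proof -
  obtain X' r s where red: "reduced X'" and iso: "iso_obj homotopic X X'"
    and nz: "\<not> zero_module (cobj X' r)" "\<not> zero_module (cobj X' s)"
    and out: "\<And>i. i < r \<or> s < i \<Longrightarrow> zero_module (cobj X' i)" and l: "int l = s - r"
    using len by (auto simp: has_length_def)
  have X': "proj_complex X'"
    using red by (simp add: reduced_def Cb_def)
  have "\<not> zero_obj map_eq X'"
    using nz zero_obj_iff[OF X'] by blast
  then have "indecomposable_C (shift (r - 1) X')"
    by (intro indecomposable_C_shift reduced_representative_indecomposable[OF ind red iso])
  moreover have "Cn (Suc l) (shift (r - 1) X')"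
    unfolding Cn_def
  proof (intro conjI allI impI proj_complex_shift X')
    fix i assume "i \<notin> {1..int (Suc l)}"
    then have "i + (r - 1) < r \<or> s < i + (r - 1)"
      using l by auto
    then show "zero_module (cobj (shift (r - 1) X') i)"
      by (simp only: shift_simps out)
  qed
  moreover have "1 + (r - 1) = r" "int (Suc l) + (r - 1) = s"
    using l by simp_all
  then have "\<not> zero_module (cobj (shift (r - 1) X') 1)"
    "\<not> zero_module (cobj (shift (r - 1) X') (int (Suc l)))"
    using nz by (simp_all only: shift_simps not_False_eq_True)
  ultimately show ?thesis
    by (auto simp: m0_cond_def)
qed

section \<open>The strong global dimension\<close>

theorem theorem3p22:
  fixes scale :: "'k::alg_closed_field \<Rightarrow> 'a::ring_1 \<Rightarrow> 'a"
  assumes "finite_dim_algebra scale"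
    and "sgldim TYPE('a) \<ge> 1"
  shows "sgldim TYPE('a) = m0 TYPE('a) - 2"
proof -
  define L where "L = {l. \<exists>X :: 'a cplx. indecomposable_Kb X \<and> has_length X l}"
  have sg: "sgldim TYPE('a) = (SUP l\<in>L. enat l)"
    by (simp add: sgldim_def L_def)
  have L_width: "\<not> m0_cond TYPE('a) (Suc l)" if "l \<in> L" for l
    using that width_of_indecomposable_Kb by (auto simp: L_def)
  have width_L: "n - 1 \<in> L" if "3 \<le> n" "\<not> m0_cond TYPE('a) n" for n
    using indecomposable_Kb_of_width[OF assms(1) that] by (simp add: L_def)
  have up: "m0_cond TYPE('a) n'" if "1 \<le> n" "n \<le> n'" "m0_cond TYPE('a) n" for n n'
    using that(2,1,3) by (induction n' rule: dec_induct) (auto intro: m0_cond_Suc[OF assms(1)])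
  have "\<exists>l\<in>L. 1 \<le> l"
  proof (rule ccontr)
    assume "\<not> (\<exists>l\<in>L. 1 \<le> l)"
    then have "(SUP l\<in>L. enat l) \<le> 0"
      by (intro SUP_least) (force simp: zero_enat_def)
    then have "(1 :: enat) \<le> 0"
      using assms(2) unfolding sg by (rule order_trans[rotated])
    then show False by simp
  qed
  \<comment> \<open>A complex of positive length already shows that width \<open>2\<close> fails, so the least width that does not occur is at least \<open>3\<close>.\<close>
  then have not2: "\<not> m0_cond TYPE('a) 2"
    using L_width up[of 2] by fastforce
  show ?thesis
  proof (cases "\<exists>n\<ge>2. m0_cond TYPE('a) n")
    case False
    have "enat n \<le> (SUP l\<in>L. enat l)" for n
    proof -
      have "n + 2 \<in> L"
        using width_L[of "n + 3"] False by simp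
      then have "enat (n + 2) \<le> (SUP l\<in>L. enat l)"
        by (rule SUP_upper)
      then show ?thesis
        by (rule order_trans[rotated]) simp
    qed
    then have "(SUP l\<in>L. enat l) = \<infinity>"
      by (metis enat_ord_simps(1) not_less_eq_eq order_refl not_infinity_eq)
    then show ?thesis
      using False by (auto simp: sg m0_def)
  next
    case True
    define N where "N = (LEAST n. 2 \<le> n \<and> m0_cond TYPE('a) n)"
    have N: "2 \<le> N" "m0_cond TYPE('a) N"
      using LeastI_ex[of "\<lambda>n. 2 \<le> n \<and> m0_cond TYPE('a) n"] True by (auto simp: N_def)
    have least: "\<not> m0_cond TYPE('a) n" if "2 \<le> n" "n < N" for n
      using not_less_Least[of n "\<lambda>n. 2 \<le> n \<and> m0_cond TYPE('a) n"] that by (auto simp: N_def)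
    have N3: "3 \<le> N"
      using N not2 by (cases "N = 2") auto
    have "l \<le> N - 2" if "l \<in> L" for l
      using L_width[OF that] up[of N "Suc l"] N by (cases "N \<le> Suc l") auto
    then have le: "(SUP l\<in>L. enat l) \<le> enat (N - 2)"
      by (intro SUP_least) simp
    have "enat (N - 2) \<le> (SUP l\<in>L. enat l)"
    \<comment> \<open>The width \<open>N - 1\<close> is realised. For \<open>N = 3\<close> the indecomposable that realises it may be contractible,
      and the lower bound \<open>1\<close> comes from the assumption on the strong global dimension.\<close>
    proof (cases "N = 3")
      case True
      then show ?thesis
        using assms(2) by (simp add: sg one_enat_def)
    next
      case False
      then have "N - 1 - 1 \<in> L"
        using N3 by (intro width_L least) auto
      then have "N - 2 \<in> L"
        by (simp add: numeral_2_eq_2)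
      then show ?thesis
        by (rule SUP_upper)
    qed
    with le have "sgldim TYPE('a) = enat (N - 2)"
      by (simp add: sg)
    then show ?thesis
      using True by (simp add: m0_def N_def numeral_eq_enat)
  qed
qed

end
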